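(* Let $A\in\mathbb{R}[\mathtt{x}]^{\alpha\times\alpha}$ be a linear pencil in the variables $\mathtt{x}=(\mathtt{x}_1,\dots,\mathtt{x}_n)$ and let $f\in\mathbb{R}[\mathtt{x}]_1$. Then $f\ge 0$ on $S_A$ if and only if there exist quadratic sos-matrices $S_1,\dots,S_n\in\mathbb{R}[\mathtt{x}]_2^{\alpha\times\alpha}$, real symmetric matrices $U_1,\dots,U_n\in\mathbb{R}^{s(1)\times s(1)}$, matrices $W_1,\dots,W_n\in\mathbb{R}^{s(2)\times s(1)}$, a real symmetric positive semidefinite matrix $S\in\mathbb{R}^{\alpha\times\alpha}$ and a real number $c\ge 0$ such that \begin{align*} &m_1^*U_im_1+m_2^*W_{i-1}m_1+\operatorname{tr}(AS_i)=0 && (i\in\{1,\dots,n\}),\\ &U_i\succeq W_i^*W_i && (i\in\{1,\dots,n\}),\\ &f-c+m_2^*W_nm_1-\operatorname{tr}(AS)=0, \end{align*} where $W_0:=0\in\mathbb{R}^{s(2)\times s(1)}$ and the equalities are identities in $\mathbb{R}[\mathtt{x}]$.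
   Context: Let $\mathtt{x}=(\mathtt{x}_1,\dots,\mathtt{x}_n)$ be commuting variables, $\mathbb{R}[\mathtt{x}]$ the polynomial ring and $\mathbb{R}[\mathtt{x}]_k$ the space of polynomials of degree at most $k$. $^*$ denotes transpose. A linear pencil of size $\alpha$ is a symmetric matrix $A\in\mathbb{R}[\mathtt{x}]^{\alpha\times\alpha}$ with entries in $\mathbb{R}[\mathtt{x}]_1$; its spectrahedron is $S_A:=\{x\in\mathbb{R}^n\mid A(x)\succeq0\}$. For real symmetric matrices, $B\succeq C$ means $B-C$ is positive semidefinite. An sos-matrix of size $\alpha$ is a matrix of the form $P^*P$ with $P\in\mathbb{R}[\mathtt{x}]^{t\times\alpha}$ for some $t\in\mathbb{N}$; it is quadratic if all its entries have degree at most $2$. For $d\in\mathbb{N}_0$, $s(d):=\dim\mathbb{R}[\mathtt{x}]_d=\binom{d+n}{n}$, and $m_d\in\mathbb{R}[\mathtt{x}]^{s(d)}$ denotes the column vector of all monomials of degree at most $d$ in $\mathtt{x}$, ordered first by degree and then lexicographically: $m_d=[1\ \mathtt{x}_1\ \mathtt{x}_2\ \dots\ \mathtt{x}_n\ \mathtt{x}_1^2\ \mathtt{x}_1\mathtt{x}_2\ \dots\ \mathtt{x}_n^d]^*$. *)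

theory Defs
  imports "Jordan_Normal_Form.Matrix" "HOL-Library.Poly_Mapping"
begin

text \<open>
  Monomials are their exponent functions and polynomials are finitely supported functions on
  monomials, with the ring structure of \<^theory>\<open>HOL-Library.Poly_Mapping\<close>.  The variables of
  the polynomial ring in \<open>n\<close> variables have the indices \<open>0, \<dots>, n - 1\<close>, in accordance with the
  indexing of vectors, so that the variable \<open>x\<^sub>i\<close> of the usual notation has index \<open>i - 1\<close>.
\<close>

type_synonym monomial = "nat \<Rightarrow>\<^sub>0 nat"

type_synonym rpoly = "monomial \<Rightarrow>\<^sub>0 real"

definition mdeg :: "monomial \<Rightarrow> nat"
  where "mdeg m = (\<Sum>i\<in>Poly_Mapping.keys m. Poly_Mapping.lookup m i)"

definition rpolys :: "nat \<Rightarrow> rpoly set"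
  where "rpolys n = {p. \<forall>m\<in>Poly_Mapping.keys p. Poly_Mapping.keys m \<subseteq> {..<n}}"

definition rpolys_upto :: "nat \<Rightarrow> nat \<Rightarrow> rpoly set"
  where "rpolys_upto n d = {p \<in> rpolys n. \<forall>m\<in>Poly_Mapping.keys p. mdeg m \<le> d}"

definition Const :: "real \<Rightarrow> rpoly"
  where "Const c = Poly_Mapping.single 0 c"

definition eval_rpoly :: "real vec \<Rightarrow> rpoly \<Rightarrow> real"
  where "eval_rpoly x p = (\<Sum>m\<in>Poly_Mapping.keys p. Poly_Mapping.lookup p m * (\<Prod>i\<in>Poly_Mapping.keys m. (x $ i) ^ Poly_Mapping.lookup m i))"

definition mat_trace :: "'a::comm_monoid_add mat \<Rightarrow> 'a"
  where "mat_trace A = (\<Sum>i<dim_row A. A $$ (i, i))"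

definition symmetric_mats :: "nat \<Rightarrow> 'a mat set"
  where "symmetric_mats k = {A \<in> carrier_mat k k. A\<^sup>T = A}"

definition psd_mats :: "nat \<Rightarrow> real mat set"
  where "psd_mats k = {A \<in> symmetric_mats k. \<forall>v\<in>carrier_vec k. 0 \<le> v \<bullet> (A *\<^sub>v v)}"

definition psd_ge :: "nat \<Rightarrow> real mat \<Rightarrow> real mat \<Rightarrow> bool"
  where "psd_ge k B C \<longleftrightarrow> B \<in> symmetric_mats k \<and> C \<in> symmetric_mats k \<and> B - C \<in> psd_mats k"

definition linear_pencil :: "nat \<Rightarrow> nat \<Rightarrow> rpoly mat \<Rightarrow> bool"
  where "linear_pencil n \<alpha> A \<longleftrightarrow> A \<in> symmetric_mats \<alpha> \<and> elements_mat A \<subseteq> rpolys_upto n 1"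

definition spectrahedron :: "nat \<Rightarrow> rpoly mat \<Rightarrow> real vec set"
  where "spectrahedron n A =
    {x \<in> carrier_vec n. map_mat (eval_rpoly x) A \<in> psd_mats (dim_row A)}"

definition sos_matrix :: "nat \<Rightarrow> nat \<Rightarrow> rpoly mat \<Rightarrow> bool"
  where "sos_matrix n \<alpha> S \<longleftrightarrow>
    (\<exists>t. \<exists>P\<in>carrier_mat t \<alpha>. elements_mat P \<subseteq> rpolys n \<and> S = P\<^sup>T * P)"

definition quadratic_sos_matrix :: "nat \<Rightarrow> nat \<Rightarrow> rpoly mat \<Rightarrow> bool"
  where "quadratic_sos_matrix n \<alpha> S \<longleftrightarrow> sos_matrix n \<alpha> S \<and> elements_mat S \<subseteq> rpolys_upto n 2"

text \<open>
  The order on \<^typ>\<open>monomial\<close> compares exponents at the smallest index where they differ, so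
  listing a homogeneous component in descending order puts \<open>x\<^sub>1\<^sup>2\<close> before \<open>x\<^sub>1 x\<^sub>2\<close>.
\<close>

definition monomial_list :: "nat \<Rightarrow> nat \<Rightarrow> monomial list"
  where "monomial_list n d =
    concat (map (\<lambda>k. rev (sorted_list_of_set {m. Poly_Mapping.keys m \<subseteq> {..<n} \<and> mdeg m = k})) [0..<Suc d])"

definition monomial_vec :: "nat \<Rightarrow> nat \<Rightarrow> rpoly vec"
  where "monomial_vec n d = vec_of_list (map (\<lambda>m. Poly_Mapping.single m 1) (monomial_list n d))"

definition num_monomials :: "nat \<Rightarrow> nat \<Rightarrow> nat"
  where "num_monomials n d = (d + n) choose n"

text \<open>The polynomial \<open>m\<^sub>d\<^sup>* M m\<^sub>e\<close> for a real matrix \<open>M\<close>:\<close>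

definition monomial_form :: "nat \<Rightarrow> nat \<Rightarrow> real mat \<Rightarrow> nat \<Rightarrow> rpoly"
  where "monomial_form n d M e = monomial_vec n d \<bullet> (map_mat Const M *\<^sub>v monomial_vec n e)"

lemma mdeg_alt:
  assumes "Poly_Mapping.keys m \<subseteq> {..<n}"
  shows "mdeg m = (\<Sum>i<n. Poly_Mapping.lookup m i)"
  unfolding mdeg_def using assms
  by (intro sum.mono_neutral_left) (auto simp: in_keys_iff)

lemma bij_betw_exponents:
  "bij_betw (\<lambda>m. map (Poly_Mapping.lookup m) [0..<n] @ [d - mdeg m])
     {m. Poly_Mapping.keys m \<subseteq> {..<n} \<and> mdeg m \<le> d} {l. length l = Suc n \<and> sum_list l = d}"
proof (rule bij_betw_byWitness[where f' = "\<lambda>l. Poly_Mapping.nth (butlast l)"])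
  have lk: "map (Poly_Mapping.lookup (Poly_Mapping.nth l)) [0..<length l] = l" for l :: "nat list"
    by (rule nth_equalityI) (auto simp: nth.rep_eq nth_default_nth)
  have ks: "Poly_Mapping.keys (Poly_Mapping.nth l) \<subseteq> {..<length l}" for l :: "nat list"
    by (auto simp: in_set_enumerate_eq)
  have md: "mdeg (Poly_Mapping.nth l) = sum_list l" for l :: "nat list"
  proof -
    have "mdeg (Poly_Mapping.nth l) = sum_list (map (Poly_Mapping.lookup (Poly_Mapping.nth l)) [0..<length l])"
      by (simp add: mdeg_alt[OF ks] sum_list_distinct_conv_sum_set atLeast0LessThan)
    then show ?thesis by (simp only: lk)
  qed
  show "\<forall>m\<in>{m. Poly_Mapping.keys m \<subseteq> {..<n} \<and> mdeg m \<le> d}.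
      Poly_Mapping.nth (butlast (map (Poly_Mapping.lookup m) [0..<n] @ [d - mdeg m])) = m"
    by (auto intro!: poly_mapping_eqI simp: nth.rep_eq nth_default_def in_keys_iff)
  have split_last: "sum_list (butlast l) + last l = sum_list l" if "length l = Suc n" for l :: "nat list"
    using that by (cases l rule: rev_cases) auto
  show "\<forall>l\<in>{l. length l = Suc n \<and> sum_list l = d}.
      map (Poly_Mapping.lookup (Poly_Mapping.nth (butlast l))) [0..<n] @ [d - mdeg (Poly_Mapping.nth (butlast l))] = l"
  proof safe
    fix l :: "nat list" assume l: "length l = Suc n" "d = sum_list l"
    have "map (Poly_Mapping.lookup (Poly_Mapping.nth (butlast l))) [0..<n] = butlast l"
      using lk[of "butlast l"] l by simp
    moreover have "sum_list l - sum_list (butlast l) = last l"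
      using split_last[OF l(1)] by linarith
    moreover have "l \<noteq> []" using l by auto
    ultimately show "map (Poly_Mapping.lookup (Poly_Mapping.nth (butlast l))) [0..<n] @
        [sum_list l - mdeg (Poly_Mapping.nth (butlast l))] = l"
      by (simp add: md)
  qed
  show "(\<lambda>m. map (Poly_Mapping.lookup m) [0..<n] @ [d - mdeg m]) ` {m. Poly_Mapping.keys m \<subseteq> {..<n} \<and> mdeg m \<le> d}
      \<subseteq> {l. length l = Suc n \<and> sum_list l = d}"
    by (auto simp: mdeg_alt sum_list_distinct_conv_sum_set atLeast0LessThan)
  show "(\<lambda>l. Poly_Mapping.nth (butlast l)) ` {l. length l = Suc n \<and> sum_list l = d}
      \<subseteq> {m. Poly_Mapping.keys m \<subseteq> {..<n} \<and> mdeg m \<le> d}"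
  proof safe
    fix l :: "nat list" and x
    assume l: "length l = Suc n" "d = sum_list l"
    show "mdeg (Poly_Mapping.nth (butlast l)) \<le> sum_list l"
      using split_last[OF l(1)] by (simp add: md)
    assume "x \<in> Poly_Mapping.keys (Poly_Mapping.nth (butlast l))"
    then show "x < n" using ks[of "butlast l"] l by auto
  qed
qed

lemma finite_monomials: "finite {m. Poly_Mapping.keys m \<subseteq> {..<n} \<and> mdeg m \<le> d}"
proof -
  have "{l. length l = Suc n \<and> sum_list l = d} \<subseteq> {l. set l \<subseteq> {..d} \<and> length l = Suc n}"
    by (auto dest: member_le_sum_list)
  then have "finite {l. length l = Suc n \<and> sum_list l = d}"
    by (rule finite_subset) (simp add: finite_lists_length_eq)
  then show ?thesis using bij_betw_finite[OF bij_betw_exponents] by blast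
qed

lemma card_monomials:
  "card {m. Poly_Mapping.keys m \<subseteq> {..<n} \<and> mdeg m \<le> d} = num_monomials n d"
  using bij_betw_same_card[OF bij_betw_exponents[of n d]] card_length_sum_list[of "Suc n" d]
  by (simp add: num_monomials_def binomial_symmetric[of n "d + n"])

lemma finite_monomials_eq: "finite {m. Poly_Mapping.keys m \<subseteq> {..<n} \<and> mdeg m = d}"
  by (rule finite_subset[OF _ finite_monomials[of n d]]) auto

lemma set_monomial_list: "set (monomial_list n d) = {m. Poly_Mapping.keys m \<subseteq> {..<n} \<and> mdeg m \<le> d}"
  by (auto simp: monomial_list_def finite_monomials_eq)

lemma distinct_monomial_list: "distinct (monomial_list n d)"
proof (induction d)
  case 0
  show ?case by (simp add: monomial_list_def)
next
  case (Suc d)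
  have "monomial_list n (Suc d) =
      monomial_list n d @ rev (sorted_list_of_set {m. Poly_Mapping.keys m \<subseteq> {..<n} \<and> mdeg m = Suc d})"
    by (simp add: monomial_list_def)
  then show ?case
    using Suc by (auto simp: finite_monomials_eq set_monomial_list)
qed

lemma dim_monomial_vec: "dim_vec (monomial_vec n d) = num_monomials n d"
  using distinct_card[OF distinct_monomial_list[of n d]]
  by (simp add: monomial_vec_def set_monomial_list card_monomials)

end

theory Submission
  imports Defs "HOL-Analysis.Function_Topology"
begin

text \<open>
  Soundness: at a point \<open>x\<close> of the spectrahedron, \<open>tr(A S\<^sub>i)\<close> is nonnegative, so inductively
  \<open>\<parallel>W\<^sub>i m\<^sub>1(x)\<parallel>\<^sup>2 \<le> m\<^sub>1(x)\<^sup>* U\<^sub>i m\<^sub>1(x) \<le> 0\<close> and \<open>W\<^sub>i\<close> contributes nothing to the next identity.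

  Completeness is facial reduction by sums of squares. Let \<open>L\<close> be a space of linear polynomials such
  that every \<open>W\<close> with rows in \<open>L\<close> can be reached after \<open>k\<close> steps. If \<open>l\<close> is a further linear
  polynomial with \<open>l\<^sup>2 + tr(A S) = 0\<close> modulo the multiples of \<open>L\<close>, then every \<open>W\<close> with rows in
  \<open>L + \<real> l\<close> can be reached after \<open>k + 1\<close> steps, because a row \<open>s l + p\<close> with \<open>p\<close> in \<open>L\<close> has the
  square \<open>s\<^sup>2 l\<^sup>2\<close> modulo the multiples of \<open>L\<close>. If there is no such \<open>l\<close> (and 1 is not in \<open>L\<close>), then
  \<open>c + tr(A S)\<close> is in \<open>L\<close> only for \<open>c = 0\<close> and \<open>A S = 0\<close> modulo \<open>L\<close>. Once \<open>S\<close> is restricted to a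
  column basis of \<open>A\<close> modulo \<open>L\<close>, the elements \<open>c + tr(A S) - t f\<close> with \<open>c + tr S + t = 1\<close> form a
  compact convex set modulo \<open>L\<close>. Either it contains 0, and \<open>f\<close> is \<open>c + tr(A S)\<close> modulo \<open>L\<close>, or
  it is strictly separated from 0 by a functional, which evaluates at a point of the spectrahedron
  where \<open>f\<close> is negative. The dimension of \<open>L\<close> grows in each step, so after \<open>n\<close> steps
  only a single point is left.
\<close>

section \<open>Positive semidefinite forms\<close>

text \<open>The form is generic in the ring, so that it covers real matrices as well as pencils
  applied to polynomial vectors. Matrices and vectors are functions, read only at indices below
  \<open>a\<close>.\<close>

definition bform :: "nat \<Rightarrow> (nat \<Rightarrow> nat \<Rightarrow> 'a::comm_ring_1) \<Rightarrow> (nat \<Rightarrow> 'a) \<Rightarrow> (nat \<Rightarrow> 'a) \<Rightarrow> 'a"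
  where "bform a M u v = (\<Sum>i<a. \<Sum>j<a. M i j * u i * v j)"

definition symm_on :: "nat \<Rightarrow> (nat \<Rightarrow> nat \<Rightarrow> 'a) \<Rightarrow> bool"
  where "symm_on a M \<longleftrightarrow> (\<forall>i<a. \<forall>j<a. M i j = M j i)"

definition psd_on :: "nat \<Rightarrow> (nat \<Rightarrow> nat \<Rightarrow> real) \<Rightarrow> bool"
  where "psd_on a M \<longleftrightarrow> symm_on a M \<and> (\<forall>v. 0 \<le> bform a M v v)"

lemma bform_commute: "symm_on a M \<Longrightarrow> bform a M u v = bform a M v u"
  unfolding bform_def symm_on_def
  by (subst sum.swap) (intro sum.cong refl, simp add: ac_simps)

lemma bform_add_left: "bform a M (\<lambda>i. u i + u' i) v = bform a M u v + bform a M u' v"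
  by (simp add: bform_def sum.distrib algebra_simps)

lemma bform_add_right: "bform a M u (\<lambda>i. v i + v' i) = bform a M u v + bform a M u v'"
  by (simp add: bform_def sum.distrib algebra_simps)

lemma bform_mult_left: "bform a M (\<lambda>i. c * u i) v = c * bform a M u v"
  by (simp add: bform_def sum_distrib_left algebra_simps)

lemma bform_mult_right: "bform a M u (\<lambda>i. c * v i) = c * bform a M u v"
  by (simp add: bform_def sum_distrib_left algebra_simps)

lemma bform_lincomb:
  assumes "symm_on a M"
  shows "bform a M (\<lambda>i. s * u i + t * v i) (\<lambda>i. s * u i + t * v i)
    = s^2 * bform a M u u + 2 * s * t * bform a M u v + t^2 * bform a M v v"
  by (simp add: bform_add_left bform_add_right bform_mult_left bform_mult_right
      bform_commute[OF assms, of v u] algebra_simps power2_eq_square)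

lemma bform_unit_left: "i < a \<Longrightarrow> bform a M (\<lambda>k. if k = i then 1 else 0) v = (\<Sum>j<a. M i j * v j)"
  by (simp add: bform_def if_distrib[of "\<lambda>x. _ * x"] if_distrib[of "\<lambda>x. x * _"] sum.swap[of _ "{..<a}"] sum.delta' cong: if_cong)

lemma bform_unit_unit: "i < a \<Longrightarrow> j < a \<Longrightarrow>
    bform a M (\<lambda>k. if k = i then 1 else 0) (\<lambda>k. if k = j then 1 else 0) = M i j"
  by (simp add: bform_unit_left if_distrib[of "\<lambda>x. _ * x"] sum.delta' cong: if_cong)

lemma psd_on_diag: "psd_on a M \<Longrightarrow> i < a \<Longrightarrow> 0 \<le> M i i"
  unfolding psd_on_def using bform_unit_unit[of i a i M] by metis

lemma psd_on_principal_pair: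
  assumes "psd_on a M" "i < a" "j < a"
  shows "0 \<le> s^2 * M i i + 2 * s * t * M i j + t^2 * M j j"
proof -
  have "0 \<le> bform a M (\<lambda>k. s * (if k = i then 1 else 0) + t * (if k = j then 1 else 0))
      (\<lambda>k. s * (if k = i then 1 else 0) + t * (if k = j then 1 else 0))"
    using assms unfolding psd_on_def by blast
  then show ?thesis
    using assms by (subst (asm) bform_lincomb) (auto simp: psd_on_def bform_unit_unit)
qed

lemma psd_on_zero_diag:
  assumes "psd_on a M" "i < a" "j < a" "M i i = 0"
  shows "M i j = 0"
proof (rule ccontr)
  assume nz: "M i j \<noteq> 0"
  have "0 \<le> 2 * s * M i j + M j j" for s
    using psd_on_principal_pair[OF assms(1-3), of s 1] assms(4) by simp
  \<comment> \<open>This \<open>s\<close> makes the affine expression equal to -1.\<close>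
  from this[of "- (M j j + 1) / (2 * M i j)"] nz show False
    by (simp add: field_simps)
qed

lemma psd_on_abs_le:
  assumes "psd_on a M" "i < a" "j < a"
  shows "2 * \<bar>M i j\<bar> \<le> M i i + M j j"
  using psd_on_principal_pair[OF assms, of 1 1] psd_on_principal_pair[OF assms, of 1 "-1"] by auto

text \<open>Cholesky elimination: after \<open>m\<close> pivots the remainder \<open>R\<close> is
  still positive semidefinite and its first \<open>m\<close> rows vanish. A nonzero pivot splits off
  a rank-one term and leaves the Schur complement; a zero pivot has a zero row and contributes the
  vector 0.\<close>

lemma psd_on_gram:
  assumes "psd_on a S"
  obtains u where "\<And>i j. i < a \<Longrightarrow> j < a \<Longrightarrow> S i j = (\<Sum>k<a. u k i * u k j)"
proof -
  have "\<exists>u R. psd_on a R \<and> (\<forall>i<a. \<forall>j<a. S i j = (\<Sum>k<m. u k i * u k j) + R i j)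
      \<and> (\<forall>i<a. \<forall>j<a. i < m \<longrightarrow> R i j = 0)" if "m \<le> a" for m
    using that
  proof (induction m)
    case 0
    show ?case using assms by (intro exI[of _ "\<lambda>_ _. 0"] exI[of _ S]) auto
  next
    case (Suc m)
    then obtain u R where R: "psd_on a R" "\<forall>i<a. \<forall>j<a. S i j = (\<Sum>k<m. u k i * u k j) + R i j"
      "\<forall>i<a. \<forall>j<a. i < m \<longrightarrow> R i j = 0" by auto
    have sym: "R i j = R j i" if "i < a" "j < a" for i j
      using R(1) that by (auto simp: psd_on_def symm_on_def)
    have m: "m < a" using Suc.prems by simp
    show ?case
    proof (cases "R m m = 0")
      case True
      have "\<forall>i<a. \<forall>j<a. i < Suc m \<longrightarrow> R i j = 0"
        using R(3) psd_on_zero_diag[OF R(1) m _ True] by (auto simp: less_Suc_eq)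
      then show ?thesis using R(1,2)
        by (intro exI[of _ "\<lambda>k. if k = m then (\<lambda>_. 0) else u k"] exI[of _ R]) auto
    next
      case False
      then have pos: "R m m > 0" using psd_on_diag[OF R(1) m] by simp
      define r where "r v = (\<Sum>j<a. R m j * v j)" for v
      define R' where "R' i j = R i j - R m i * R m j / R m m" for i j
      have bR': "bform a R' v v = bform a R v v - (r v)^2 / R m m" for v
      proof -
        have "bform a (\<lambda>i j. R m i * R m j / R m m) v v = (r v)^2 / R m m"
          unfolding bform_def r_def power2_eq_square sum_product sum_divide_distrib
          by (intro sum.cong refl) simp
        then show ?thesis
          unfolding R'_def bform_def by (simp add: sum_subtractf algebra_simps)
      qed
      have "0 \<le> bform a R' v v" for v
      proof -
        \<comment> \<open>This \<open>t\<close> minimises the form of \<open>R\<close> along the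
          line from \<open>v\<close> in direction of the pivot; the minimum is the value of the
          Schur complement \<open>R'\<close> at \<open>v\<close>.\<close>
        define t where "t = - r v / R m m"
        let ?e = "\<lambda>k. if k = m then 1 else (0::real)"
        have "0 \<le> bform a R (\<lambda>k. t * ?e k + 1 * v k) (\<lambda>k. t * ?e k + 1 * v k)"
          using R(1) unfolding psd_on_def by blast
        also have "\<dots> = t^2 * R m m + 2 * t * r v + bform a R v v"
          using R(1) m by (subst bform_lincomb) (auto simp: psd_on_def bform_unit_unit bform_unit_left r_def)
        also have "\<dots> = bform a R' v v"
          using pos unfolding bR' t_def by (simp add: field_simps power2_eq_square)
        finally show ?thesis .
      qed
      moreover have "symm_on a R'"
        using sym by (auto simp: symm_on_def R'_def)
      ultimately have "psd_on a R'" by (simp add: psd_on_def)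
      moreover have "R' i j = 0" if "i < a" "j < a" "i < Suc m" for i j
        using that R(3) pos m sym[of m i] by (auto simp: R'_def less_Suc_eq)
      moreover have "S i j = (\<Sum>k<Suc m. (u(m := \<lambda>i. R m i / sqrt (R m m))) k i * (u(m := \<lambda>i. R m i / sqrt (R m m))) k j) + R' i j"
        if "i < a" "j < a" for i j
        using that R(2) pos by (simp add: R'_def)
      ultimately show ?thesis by blast
    qed
  qed
  from this[OF order_refl] obtain u R where "\<forall>i<a. \<forall>j<a. S i j = (\<Sum>k<a. u k i * u k j) + R i j"
    "\<forall>i<a. \<forall>j<a. i < a \<longrightarrow> R i j = 0" by blast
  then show ?thesis using that[of u] by auto
qed

section \<open>Separation from compact convex sets, and compact slices of the semidefinite
  cone\<close>

text \<open>The separating functional is the inner product with a point \<open>y\<close> of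
  \<open>Y\<close> of least norm in the coordinates \<open>I\<close>: if some \<open>z\<close> had a
  nonpositive product with \<open>y\<close>, a small move from \<open>y\<close> towards
  \<open>z\<close> would shorten \<open>y\<close>.\<close>

lemma min_norm_separation:
  fixes Y :: "('i \<Rightarrow> real) set"
  assumes "compact Y" "Y \<noteq> {}" "finite I"
    and conv: "\<forall>y\<in>Y. \<forall>z\<in>Y. \<forall>t\<in>{0..1}. (\<lambda>i. (1 - t) * y i + t * z i) \<in> Y"
    and nz: "\<forall>y\<in>Y. \<exists>i\<in>I. y i \<noteq> 0"
  shows "\<exists>y. \<forall>z\<in>Y. 0 < (\<Sum>i\<in>I. y i * z i)"
proof -
  have "continuous_on Y (\<lambda>y. \<Sum>i\<in>I. (y i)^2)"
    by (intro continuous_intros continuous_on_subset[OF continuous_on_product_coordinates]) auto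
  then obtain y where y: "y \<in> Y" "\<And>z. z \<in> Y \<Longrightarrow> (\<Sum>i\<in>I. (y i)^2) \<le> (\<Sum>i\<in>I. (z i)^2)"
    using continuous_attains_inf[OF assms(1,2)] by blast
  obtain i where "i \<in> I" "y i \<noteq> 0" using nz y(1) by blast
  then have pos: "0 < (\<Sum>i\<in>I. (y i)^2)"
    using \<open>finite I\<close> by (intro sum_pos2[of _ i]) auto
  have "0 < (\<Sum>i\<in>I. y i * z i)" if z: "z \<in> Y" for z
  proof (rule ccontr)
    assume neg: "\<not> ?thesis"
    define N P D where "N = (\<Sum>i\<in>I. (y i)^2)" and "P = (\<Sum>i\<in>I. y i * z i)" and "D = (\<Sum>i\<in>I. (z i - y i)^2)"
    have "N \<le> N - 2 * t * (N - P) + t^2 * D" if t: "0 \<le> t" "t \<le> 1" for t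
    proof -
      have "N \<le> (\<Sum>i\<in>I. ((1 - t) * y i + t * z i)^2)"
        unfolding N_def using conv y(1) z t by (intro y(2)) auto
      also have "\<dots> = (\<Sum>i\<in>I. (y i)^2 - 2 * t * ((y i)^2 - y i * z i) + t^2 * (z i - y i)^2)"
        by (intro sum.cong refl) (simp add: power2_eq_square algebra_simps)
      also have "\<dots> = N - 2 * t * (N - P) + t^2 * D"
        unfolding N_def P_def D_def by (simp add: sum.distrib sum_subtractf sum_distrib_left right_diff_distrib)
      finally show ?thesis .
    qed
    then have *: "2 * t * (N - P) \<le> t^2 * D" if "0 \<le> t" "t \<le> 1" for t using that by fastforce
    have N: "N > 0" "P \<le> 0" using pos neg by (auto simp: N_def P_def)
    have "D \<ge> 0" unfolding D_def by (simp add: sum_nonneg)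
    \<comment> \<open>Small enough that \<open>t * D\<close> is at most \<open>N\<close>, whereas
      \<open>2 * (N - P)\<close> is at least \<open>2 * N\<close>.\<close>
    define t where "t = N / (N + D)"
    have t: "0 < t" "t \<le> 1" using N \<open>D \<ge> 0\<close> by (auto simp: t_def)
    have "2 * (N - P) \<le> t * D"
      using *[of t] t by (simp add: power2_eq_square)
    also have "t * D \<le> N"
      using N \<open>D \<ge> 0\<close> by (simp add: t_def field_simps)
    finally show False using N by simp
  qed
  then show ?thesis by blast
qed

text \<open>Tychonoff's theorem, applied once for each of the two arguments.\<close>

lemma compact_cube: "compact {g :: nat \<Rightarrow> nat \<Rightarrow> real. \<forall>i j. g i j \<in> {-1..1}}"
proof -
  have 1: "compact {g :: 'i \<Rightarrow> 'b::topological_space. \<forall>i. g i \<in> K}" if "compact K" for K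
  proof -
    have "compactin (product_topology (\<lambda>_::'i. euclidean :: 'b topology) UNIV) (PiE UNIV (\<lambda>_. K))"
      using that by (subst compactin_PiE) (auto)
    moreover have "PiE UNIV (\<lambda>_. K) = {g :: 'i \<Rightarrow> 'b. \<forall>i. g i \<in> K}" by auto
    ultimately show ?thesis by (simp add: euclidean_product_topology)
  qed
  have "compact {g :: nat \<Rightarrow> nat \<Rightarrow> real. \<forall>i. g i \<in> {h. \<forall>j. h j \<in> {-1..1}}}"
    by (intro 1 compact_Icc)
  then show ?thesis by simp
qed

text \<open>Normalized data for the elements c + tr(A S) - t f, with \<open>S\<close> supported on
  rows and columns in \<open>J\<close>. The zero condition is also imposed on indices from
  \<open>a\<close> on: if \<open>J\<close> lies below \<open>a\<close>, it bounds all entries of the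
  function \<open>S\<close>, as compactness in the function space demands.\<close>

definition psd_slice :: "nat \<Rightarrow> nat set \<Rightarrow> (real \<times> (nat \<Rightarrow> nat \<Rightarrow> real) \<times> real) set"
  where "psd_slice a J = {(c, S, t). 0 \<le> c \<and> 0 \<le> t \<and> (\<forall>i j. S i j = S j i) \<and>
    (\<forall>i j. i \<notin> J \<longrightarrow> S i j = 0) \<and> (\<forall>v. 0 \<le> bform a S v v) \<and> c + (\<Sum>i<a. S i i) + t = 1}"

lemma continuous_on_matrix_entry:
  "continuous_on A (\<lambda>x :: 'a::topological_space \<times> (nat \<Rightarrow> nat \<Rightarrow> real) \<times> 'b::topological_space. fst (snd x) i j)"
proof -
  have "continuous_on A (\<lambda>x :: 'a \<times> (nat \<Rightarrow> nat \<Rightarrow> real) \<times> 'b. fst (snd x))"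
    by (intro continuous_on_fst continuous_on_snd continuous_on_id)
  from continuous_on_product_then_coordinatewise[OF continuous_on_product_then_coordinatewise[OF this, of i], of j]
  show ?thesis .
qed

lemma closed_psd_slice: "closed (psd_slice a J)"
proof -
  \<comment> \<open>Written with projections, and with the support condition as an equation with a
    0-1 coefficient, every condition compares two continuous functions.\<close>
  have "psd_slice a J = {x. 0 \<le> fst x \<and> 0 \<le> snd (snd x) \<and> (\<forall>i j. fst (snd x) i j = fst (snd x) j i) \<and>
    (\<forall>i j. of_bool (i \<notin> J) * fst (snd x) i j = 0) \<and>
    (\<forall>v. 0 \<le> bform a (\<lambda>i j. fst (snd x) i j) v v) \<and> fst x + (\<Sum>i<a. fst (snd x) i i) + snd (snd x) = 1}"
    by (auto simp: psd_slice_def)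
  also have "closed \<dots>"
    unfolding bform_def
    by (intro closed_Collect_conj closed_Collect_all closed_Collect_eq closed_Collect_le
        continuous_on_sum continuous_on_add continuous_on_mult continuous_on_const continuous_on_matrix_entry
        continuous_on_fst continuous_on_snd continuous_on_id)
  finally show ?thesis .
qed

text \<open>The diagonal of \<open>S\<close> is nonnegative with sum at most 1, and it bounds the
  other entries by \<open>psd_on_abs_le\<close>; so the slice is a closed subset of a compact
  box.\<close>

lemma compact_psd_slice:
  assumes "J \<subseteq> {..<a}"
  shows "compact (psd_slice a J)"
proof -
  have "(c, S, t) \<in> {0..1} \<times> {g. \<forall>i j. g i j \<in> {-1..1}} \<times> {0..1}" if x: "(c, S, t) \<in> psd_slice a J" for c S t
  proof -
    have psd: "psd_on a S" using x by (auto simp: psd_slice_def psd_on_def symm_on_def)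
    have diag: "0 \<le> S i i" if "i < a" for i using psd_on_diag[OF psd that] .
    then have tr: "0 \<le> (\<Sum>i<a. S i i)" by (intro sum_nonneg) auto
    have sum1: "0 \<le> c" "0 \<le> t" "c + (\<Sum>i<a. S i i) + t = 1" using x by (auto simp: psd_slice_def)
    have le1: "S i i \<le> 1" if "i < a" for i
    proof -
      have "S i i \<le> (\<Sum>i<a. S i i)" using that diag by (intro member_le_sum) auto
      then show ?thesis using sum1 by linarith
    qed
    have "\<bar>S i j\<bar> \<le> 1" if "i < a" "j < a" for i j
      using psd_on_abs_le[OF psd that] le1[OF that(1)] le1[OF that(2)] by linarith
    moreover have "S i j = 0" if "\<not> (i < a \<and> j < a)" for i j
    proof -
      have "i \<notin> J \<or> j \<notin> J" using that assms by auto
      moreover have "S i j = S j i" "i \<notin> J \<Longrightarrow> S i j = 0" "j \<notin> J \<Longrightarrow> S j i = 0"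
        using x unfolding psd_slice_def by blast+
      ultimately show ?thesis by auto
    qed
    ultimately have "\<bar>S i j\<bar> \<le> 1" for i j by (cases "i < a \<and> j < a") auto
    then have "\<forall>i j. S i j \<in> {-1..1}" by (auto simp: abs_le_iff minus_le_iff)
    then show ?thesis using sum1 tr by auto
  qed
  then have "psd_slice a J = ({0..1} \<times> {g. \<forall>i j. g i j \<in> {-1..1}} \<times> {0..1}) \<inter> psd_slice a J" by auto
  moreover have "compact (({0..1} \<times> {g. \<forall>i j. g i j \<in> {-1..1}} \<times> {0..1}) \<inter> psd_slice a J)"
    by (intro compact_Int_closed compact_Times compact_cube closed_psd_slice compact_Icc)
  ultimately show ?thesis by simp
qed

lemma psd_slice_convex:
  assumes "(c, S, t) \<in> psd_slice a J" "(c', S', t') \<in> psd_slice a J" "0 \<le> r" "r \<le> 1"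
  shows "((1 - r) * c + r * c', (\<lambda>i j. (1 - r) * S i j + r * S' i j), (1 - r) * t + r * t') \<in> psd_slice a J"
proof -
  have "bform a (\<lambda>i j. (1 - r) * S i j + r * S' i j) v v = (1 - r) * bform a S v v + r * bform a S' v v" for v
    by (simp add: bform_def sum_distrib_left sum.distrib sum_subtractf algebra_simps)
  moreover have "(1 - r) * c + r * c' + (\<Sum>i<a. (1 - r) * S i i + r * S' i i) + ((1 - r) * t + r * t')
    = (1 - r) * (c + (\<Sum>i<a. S i i) + t) + r * (c' + (\<Sum>i<a. S' i i) + t')"
    by (simp add: sum_distrib_left sum.distrib sum_subtractf algebra_simps)
  ultimately show ?thesis
    using assms by (auto simp: psd_slice_def intro!: add_nonneg_nonneg mult_nonneg_nonneg)
qed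

section \<open>Polynomials and linear functionals\<close>

abbreviation monomials :: "nat \<Rightarrow> nat \<Rightarrow> monomial set"
  where "monomials n d \<equiv> {m. Poly_Mapping.keys m \<subseteq> {..<n} \<and> mdeg m \<le> d}"

abbreviation X :: "monomial \<Rightarrow> rpoly"
  where "X m \<equiv> Poly_Mapping.single m 1"

lemma Const_0 [simp]: "Const 0 = 0" and Const_1 [simp]: "Const 1 = 1"
  and Const_add: "Const (a + b) = Const a + Const b"
  and Const_uminus: "Const (- a) = - Const a"
  and Const_diff: "Const (a - b) = Const a - Const b"
  and Const_mult: "Const (a * b) = Const a * Const b"
  by (simp_all add: Const_def single_add single_uminus single_diff mult_single)

lemma Const_sum: "Const (sum f I) = (\<Sum>i\<in>I. Const (f i))"
  by (induction I rule: infinite_finite_induct) (auto simp: Const_add)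

lemma lookup_Const_mult: "Poly_Mapping.lookup (Const c * p) m = c * Poly_Mapping.lookup p m"
  unfolding Const_def mult_map_scale_conv_mult[symmetric]
  by (simp add: Poly_Mapping.map.rep_eq when_def)

lemma Const_mult_single: "Const c * Poly_Mapping.single m d = Poly_Mapping.single m (c * d)"
  by (simp add: Const_def mult_single)

lemma rpolys_upto_iff: "p \<in> rpolys_upto n d \<longleftrightarrow> Poly_Mapping.keys p \<subseteq> monomials n d"
  by (auto simp: rpolys_upto_def rpolys_def)

lemma rpolys_upto_lookup:
  "p \<in> rpolys_upto n d \<longleftrightarrow> (\<forall>m. Poly_Mapping.lookup p m \<noteq> 0 \<longrightarrow> m \<in> monomials n d)"
  by (auto simp: rpolys_upto_iff in_keys_iff)

lemma mdeg_0 [simp]: "mdeg 0 = 0"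
  by (simp add: mdeg_def)

lemma rpolys_upto_0 [simp]: "0 \<in> rpolys_upto n d"
  by (simp add: rpolys_upto_iff)

lemma rpolys_upto_add: "p \<in> rpolys_upto n d \<Longrightarrow> q \<in> rpolys_upto n d \<Longrightarrow> p + q \<in> rpolys_upto n d"
  using keys_add[of p q] by (auto simp: rpolys_upto_iff)

lemma rpolys_upto_sum: "(\<And>i. i \<in> I \<Longrightarrow> p i \<in> rpolys_upto n d) \<Longrightarrow> sum p I \<in> rpolys_upto n d"
  by (induction I rule: infinite_finite_induct) (auto intro: rpolys_upto_add)

lemma rpolys_upto_Const_mult: "p \<in> rpolys_upto n d \<Longrightarrow> Const c * p \<in> rpolys_upto n d"
  by (auto simp: rpolys_upto_lookup lookup_Const_mult)

lemma rpolys_upto_uminus: "p \<in> rpolys_upto n d \<Longrightarrow> - p \<in> rpolys_upto n d"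
  by (simp add: rpolys_upto_lookup)

lemma rpolys_upto_diff: "p \<in> rpolys_upto n d \<Longrightarrow> q \<in> rpolys_upto n d \<Longrightarrow> p - q \<in> rpolys_upto n d"
  by (metis rpolys_upto_add rpolys_upto_uminus diff_conv_add_uminus)

lemma rpolys_upto_Const [simp]: "Const c \<in> rpolys_upto n d"
  by (simp add: rpolys_upto_lookup Const_def lookup_single when_def)

lemma rpolys_upto_1 [simp]: "1 \<in> rpolys_upto n d"
  using rpolys_upto_Const[of 1] by simp

lemma mdeg_add:
  assumes "Poly_Mapping.keys a \<subseteq> {..<n}" "Poly_Mapping.keys b \<subseteq> {..<n}"
  shows "mdeg (a + b) = mdeg a + mdeg b"
proof -
  have "Poly_Mapping.keys (a + b) \<subseteq> {..<n}" using assms keys_add[of a b] by blast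
  then show ?thesis using assms by (simp add: mdeg_alt lookup_add sum.distrib)
qed

lemma rpolys_upto_mult:
  assumes "p \<in> rpolys_upto n d" "q \<in> rpolys_upto n e"
  shows "p * q \<in> rpolys_upto n (d + e)"
proof -
  have "a + b \<in> monomials n (d + e)" if "a \<in> monomials n d" "b \<in> monomials n e" for a b
    using that keys_add[of a b] mdeg_add[of a n b] by auto
  then show ?thesis
    using assms keys_mult[of p q] unfolding rpolys_upto_iff by blast
qed

lemma rpoly_expand:
  assumes "finite K" "Poly_Mapping.keys p \<subseteq> K"
  shows "p = (\<Sum>m\<in>K. Const (Poly_Mapping.lookup p m) * X m)"
proof (rule poly_mapping_eqI)
  fix k
  show "Poly_Mapping.lookup p k = Poly_Mapping.lookup (\<Sum>m\<in>K. Const (Poly_Mapping.lookup p m) * X m) k"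
    using assms by (auto simp: lookup_sum lookup_Const_mult lookup_single when_def in_keys_iff
        if_distrib[of "\<lambda>x. _ * x"] cong: if_cong)
qed

section \<open>Evaluation at a point is a ring homomorphism\<close>

definition eval_monomial :: "real vec \<Rightarrow> monomial \<Rightarrow> real"
  where "eval_monomial x m = (\<Prod>i\<in>Poly_Mapping.keys m. (x $ i) ^ Poly_Mapping.lookup m i)"

lemma eval_monomial_superset:
  assumes "finite K" "Poly_Mapping.keys m \<subseteq> K"
  shows "eval_monomial x m = (\<Prod>i\<in>K. (x $ i) ^ Poly_Mapping.lookup m i)"
  unfolding eval_monomial_def using assms
  by (intro prod.mono_neutral_left) (auto simp: in_keys_iff)

lemma eval_monomial_0 [simp]: "eval_monomial x 0 = 1"
  by (simp add: eval_monomial_def)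

lemma eval_monomial_add: "eval_monomial x (a + b) = eval_monomial x a * eval_monomial x b"
proof -
  let ?K = "Poly_Mapping.keys a \<union> Poly_Mapping.keys b"
  have "finite ?K" "Poly_Mapping.keys a \<subseteq> ?K" "Poly_Mapping.keys b \<subseteq> ?K" "Poly_Mapping.keys (a + b) \<subseteq> ?K"
    using keys_add[of a b] by auto
  then show ?thesis
    by (simp only: eval_monomial_superset[of ?K] lookup_add power_add prod.distrib)
qed

lemma eval_rpoly_superset:
  assumes "finite K" "Poly_Mapping.keys p \<subseteq> K"
  shows "eval_rpoly x p = (\<Sum>m\<in>K. Poly_Mapping.lookup p m * eval_monomial x m)"
  unfolding eval_rpoly_def eval_monomial_def[symmetric] using assms
  by (intro sum.mono_neutral_left) (auto simp: in_keys_iff)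

lemma eval_rpoly_add: "eval_rpoly x (p + q) = eval_rpoly x p + eval_rpoly x q"
proof -
  let ?K = "Poly_Mapping.keys p \<union> Poly_Mapping.keys q"
  have "finite ?K" "Poly_Mapping.keys p \<subseteq> ?K" "Poly_Mapping.keys q \<subseteq> ?K" "Poly_Mapping.keys (p + q) \<subseteq> ?K"
    using keys_add[of p q] by auto
  then show ?thesis
    by (simp only: eval_rpoly_superset[of ?K] lookup_add distrib_right sum.distrib)
qed

lemma eval_rpoly_0 [simp]: "eval_rpoly x 0 = 0"
  by (simp add: eval_rpoly_def)

lemma eval_rpoly_single: "eval_rpoly x (Poly_Mapping.single m c) = c * eval_monomial x m"
  by (subst eval_rpoly_superset[of "{m}"]) auto

lemma eval_rpoly_Const [simp]: "eval_rpoly x (Const c) = c"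
  by (simp add: Const_def eval_rpoly_single)

lemma eval_rpoly_sum: "eval_rpoly x (sum p I) = (\<Sum>i\<in>I. eval_rpoly x (p i))"
  by (induction I rule: infinite_finite_induct) (auto simp: eval_rpoly_add)

lemma eval_rpoly_mult: "eval_rpoly x (p * q) = eval_rpoly x p * eval_rpoly x q"
proof -
  let ?s = "\<lambda>p m. Poly_Mapping.single m (Poly_Mapping.lookup p m) :: rpoly"
  have expand: "p = (\<Sum>m\<in>Poly_Mapping.keys p. ?s p m)" for p
    using rpoly_expand[of "Poly_Mapping.keys p" p] by (simp add: Const_mult_single)
  have "eval_rpoly x (p * q) = eval_rpoly x (\<Sum>a\<in>Poly_Mapping.keys p. \<Sum>b\<in>Poly_Mapping.keys q. ?s p a * ?s q b)"
    using arg_cong2[OF expand[of p] expand[of q], of "(*)"] by (simp only: sum_product)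
  also have "\<dots> = (\<Sum>a\<in>Poly_Mapping.keys p. \<Sum>b\<in>Poly_Mapping.keys q. eval_rpoly x (?s p a) * eval_rpoly x (?s q b))"
    by (simp add: eval_rpoly_sum mult_single eval_rpoly_single eval_monomial_add algebra_simps)
  also have "\<dots> = eval_rpoly x p * eval_rpoly x q"
    by (simp only: sum_product[symmetric] eval_rpoly_sum[symmetric] expand[symmetric])
  finally show ?thesis .
qed

lemma eval_rpoly_uminus: "eval_rpoly x (- p) = - eval_rpoly x p"
  using eval_rpoly_add[of x p "- p"] by simp

lemma eval_rpoly_diff: "eval_rpoly x (p - q) = eval_rpoly x p - eval_rpoly x q"
  using eval_rpoly_add[of x p "- q"] eval_rpoly_uminus[of x q] by simp

section \<open>Monomial vectors, and polynomials of degree at most one\<close>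

text \<open>Passes from matrix indices to monomials, by which the rows of the matrices are indexed
  in the reduction.\<close>

lemma sum_num_monomials: "(\<Sum>i<num_monomials n d. g (monomial_list n d ! i)) = (\<Sum>m\<in>monomials n d. g m)"
proof -
  have len: "length (monomial_list n d) = num_monomials n d"
    using dim_monomial_vec[of n d] by (simp add: monomial_vec_def)
  have "(\<Sum>m\<in>monomials n d. g m) = sum_list (map g (monomial_list n d))"
    by (simp add: sum_list_distinct_conv_sum_set distinct_monomial_list set_monomial_list)
  then show ?thesis
    by (simp add: sum_list_sum_nth len atLeast0LessThan)
qed

lemma monomial_form_eq:
  assumes "M \<in> carrier_mat (num_monomials n d) (num_monomials n e)"
  shows "monomial_form n d M e = (\<Sum>i<num_monomials n d. X (monomial_list n d ! i) *
      (\<Sum>j<num_monomials n e. Const (M $$ (i, j)) * X (monomial_list n e ! j)))"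
proof -
  have len: "length (monomial_list n d) = num_monomials n d" for d
    using dim_monomial_vec[of n d] by (simp add: monomial_vec_def)
  show ?thesis
    using assms
    by (simp add: monomial_form_def scalar_prod_def mult_mat_vec_def atLeast0LessThan dim_monomial_vec)
      (simp add: monomial_vec_def vec_of_list_index len)
qed

lemma monomials_1: "monomials n 1 = insert 0 ((\<lambda>i. Poly_Mapping.single i 1) ` {..<n})"
proof (intro equalityI subsetI)
  fix m assume m: "m \<in> monomials n 1"
  show "m \<in> insert 0 ((\<lambda>i. Poly_Mapping.single i 1) ` {..<n})"
  proof (cases "m = 0")
    case False
    then obtain i where i: "i \<in> Poly_Mapping.keys m" by fastforce
    then have in_n: "i < n" using m by auto
    have "(\<Sum>j\<in>Poly_Mapping.keys m. Poly_Mapping.lookup m j) \<le> 1" using m by (simp add: mdeg_def)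
    then have "Poly_Mapping.lookup m i + (\<Sum>j\<in>Poly_Mapping.keys m - {i}. Poly_Mapping.lookup m j) \<le> 1"
      using i by (simp add: sum.remove)
    moreover have "Poly_Mapping.lookup m i \<noteq> 0" using i by (simp add: in_keys_iff)
    ultimately have 1: "Poly_Mapping.lookup m i = 1" and 0: "(\<Sum>j\<in>Poly_Mapping.keys m - {i}. Poly_Mapping.lookup m j) = 0"
      by linarith+
    have "Poly_Mapping.lookup m k = Poly_Mapping.lookup (Poly_Mapping.single i 1) k" for k
      using 1 0 by (cases "k = i") (auto simp: lookup_single_not_eq in_keys_iff)
    then have "m = Poly_Mapping.single i 1" by (rule poly_mapping_eqI)
    then show ?thesis using in_n by blast
  qed simp
next
  fix m :: monomial assume "m \<in> insert 0 ((\<lambda>i. Poly_Mapping.single i 1) ` {..<n})"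
  then show "m \<in> monomials n 1" by (auto simp: mdeg_def)
qed

lemma card_monomials_1: "card (monomials n 1) = Suc n"
  by (simp add: card_monomials num_monomials_def)

lemma rpolys_upto_1_expand:
  assumes "p \<in> rpolys_upto n 1"
  shows "p = Const (Poly_Mapping.lookup p 0)
    + (\<Sum>i<n. Const (Poly_Mapping.lookup p (Poly_Mapping.single i 1)) * X (Poly_Mapping.single i 1))"
proof -
  have inj: "inj_on (\<lambda>i::nat. Poly_Mapping.single i (1::nat)) {..<n}"
    by (intro inj_onI) (metis lookup_single_eq lookup_single_not_eq zero_neq_one)
  have "p = (\<Sum>m\<in>monomials n 1. Const (Poly_Mapping.lookup p m) * X m)"
    using assms by (intro rpoly_expand) (simp_all add: finite_monomials rpolys_upto_iff)
  also have "\<dots> = Const (Poly_Mapping.lookup p 0) * X 0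
    + (\<Sum>m\<in>(\<lambda>i. Poly_Mapping.single i 1) ` {..<n}. Const (Poly_Mapping.lookup p m) * X m)"
    unfolding monomials_1
  proof (rule sum.insert)
    show "(0 :: monomial) \<notin> (\<lambda>i. Poly_Mapping.single i 1) ` {..<n}"
      by (metis (no_types, lifting) imageE lookup_single_eq lookup_zero zero_neq_one)
  qed simp
  also have "\<dots> = Const (Poly_Mapping.lookup p 0)
    + (\<Sum>i<n. Const (Poly_Mapping.lookup p (Poly_Mapping.single i 1)) * X (Poly_Mapping.single i 1))"
    using inj by (simp add: sum.reindex)
  finally show ?thesis .
qed

section \<open>Linear functionals on the polynomial ring\<close>

definition linear_functional :: "(rpoly \<Rightarrow> real) \<Rightarrow> bool"
  where "linear_functional \<phi> \<longleftrightarrow> (\<forall>p q. \<phi> (p + q) = \<phi> p + \<phi> q) \<and> (\<forall>c p. \<phi> (Const c * p) = c * \<phi> p)"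

lemma linear_functionalD:
  assumes "linear_functional \<phi>"
  shows "\<phi> (p + q) = \<phi> p + \<phi> q" "\<phi> (Const c * p) = c * \<phi> p" "\<phi> 0 = 0" "\<phi> (- p) = - \<phi> p"
    "\<phi> (p - q) = \<phi> p - \<phi> q" "\<phi> (Const c) = c * \<phi> 1" "\<phi> (sum g J) = (\<Sum>i\<in>J. \<phi> (g i))"
proof -
  have add: "\<phi> (p + q) = \<phi> p + \<phi> q" and scale: "\<phi> (Const c * p) = c * \<phi> p" for p q c
    using assms by (auto simp: linear_functional_def)
  show "\<phi> (p + q) = \<phi> p + \<phi> q" "\<phi> (Const c * p) = c * \<phi> p" by (fact add scale)+
  show zero: "\<phi> 0 = 0" using scale[of 0 0] by simp
  show uminus: "\<phi> (- p) = - \<phi> p" for p using scale[of "-1" p] by (simp add: Const_uminus)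
  show "\<phi> (p - q) = \<phi> p - \<phi> q" using add[of p "- q"] uminus[of q] by simp
  show "\<phi> (Const c) = c * \<phi> 1" using scale[of c 1] by simp
  show "\<phi> (sum g J) = (\<Sum>i\<in>J. \<phi> (g i))"
    by (induction J rule: infinite_finite_induct) (auto simp: add zero)
qed

lemma linear_functional_combination:
  assumes "\<And>m. m \<in> I \<Longrightarrow> linear_functional (\<pi> m)"
  shows "linear_functional (\<lambda>p. \<Sum>m\<in>I. y m * \<pi> m p)"
  using assms unfolding linear_functional_def
  by (auto simp: sum_distrib_left algebra_simps simp flip: sum.distrib intro!: sum.cong)

section \<open>Facial reduction\<close>

definition rpoly_subspace :: "rpoly set \<Rightarrow> bool"
  where "rpoly_subspace L \<longleftrightarrow> 0 \<in> L \<and> (\<forall>p\<in>L. \<forall>q\<in>L. p + q \<in> L) \<and> (\<forall>c. \<forall>p\<in>L. Const c * p \<in> L)"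

lemma rpoly_subspaceD:
  assumes "rpoly_subspace L"
  shows "0 \<in> L" "p \<in> L \<Longrightarrow> q \<in> L \<Longrightarrow> p + q \<in> L" "p \<in> L \<Longrightarrow> Const c * p \<in> L"
  using assms by (auto simp: rpoly_subspace_def)

lemma rpoly_subspace_uminus: "rpoly_subspace L \<Longrightarrow> p \<in> L \<Longrightarrow> - p \<in> L"
  using rpoly_subspaceD(3)[of L p "-1"] by (simp add: Const_uminus)

text \<open>These are the polynomials m_2^T W m_1 for which every row of \<open>W\<close>, read as a
  linear polynomial, lies in \<open>L\<close>: the contributions that a matrix from the preceding
  step can make.\<close>

definition quad_multiples :: "nat \<Rightarrow> rpoly set \<Rightarrow> rpoly set"
  where "quad_multiples n L = {\<Sum>m\<in>monomials n 2. X m * w m | w. \<forall>m. w m \<in> L}"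

lemma quad_multiplesI: "(\<And>m. w m \<in> L) \<Longrightarrow> (\<Sum>m\<in>monomials n 2. X m * w m) \<in> quad_multiples n L"
  by (auto simp: quad_multiples_def)

lemma quad_multiples_add:
  assumes "rpoly_subspace L" "p \<in> quad_multiples n L" "q \<in> quad_multiples n L"
  shows "p + q \<in> quad_multiples n L"
proof -
  obtain v w where "p = (\<Sum>m\<in>monomials n 2. X m * v m)" "q = (\<Sum>m\<in>monomials n 2. X m * w m)"
    and vw: "\<forall>m. v m \<in> L" "\<forall>m. w m \<in> L" using assms(2,3) by (auto simp: quad_multiples_def)
  then have "p + q = (\<Sum>m\<in>monomials n 2. X m * (v m + w m))"
    by (simp add: sum.distrib distrib_left)
  then show ?thesis
    using vw quad_multiplesI[of "\<lambda>m. v m + w m" L n] rpoly_subspaceD(2)[OF assms(1)] by simp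
qed

text \<open>Expanding \<open>r\<close> into monomials gives the monomial \<open>m\<close> the row
  \<open>p\<close>, scaled by the coefficient of \<open>m\<close> in \<open>r\<close>.\<close>

lemma quad_multiples_mult:
  assumes "rpoly_subspace L" "p \<in> L" "r \<in> rpolys_upto n 2"
  shows "r * p \<in> quad_multiples n L"
proof -
  have "r = (\<Sum>m\<in>monomials n 2. Const (Poly_Mapping.lookup r m) * X m)"
    using assms(3) by (intro rpoly_expand) (simp_all add: finite_monomials rpolys_upto_iff)
  then have "r * p = (\<Sum>m\<in>monomials n 2. Const (Poly_Mapping.lookup r m) * X m) * p" by simp
  also have "\<dots> = (\<Sum>m\<in>monomials n 2. X m * (Const (Poly_Mapping.lookup r m) * p))"
    by (simp add: sum_distrib_left sum_distrib_right algebra_simps)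
  finally show ?thesis
    using quad_multiplesI rpoly_subspaceD(3)[OF assms(1,2)] by simp
qed

lemma quad_multiples_sum:
  "rpoly_subspace L \<Longrightarrow> (\<And>i. i \<in> J \<Longrightarrow> g i \<in> quad_multiples n L) \<Longrightarrow> sum g J \<in> quad_multiples n L"
proof (induction J rule: infinite_finite_induct)
  case (insert i J)
  then show ?case by (auto intro: quad_multiples_add)
qed (use quad_multiples_mult[of L 0 0 n] in \<open>auto dest: rpoly_subspaceD\<close>)

lemma quad_multiples_Const_mult:
  assumes "rpoly_subspace L" "p \<in> quad_multiples n L"
  shows "Const c * p \<in> quad_multiples n L"
proof -
  obtain w where "p = (\<Sum>m\<in>monomials n 2. X m * w m)" and w: "\<forall>m. w m \<in> L"
    using assms(2) by (auto simp: quad_multiples_def)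
  then have "Const c * p = (\<Sum>m\<in>monomials n 2. X m * (Const c * w m))"
    by (simp add: sum_distrib_left mult.left_commute)
  then show ?thesis
    using w quad_multiplesI[of "\<lambda>m. Const c * w m" L n] rpoly_subspaceD(3)[OF assms(1)] by simp
qed

lemma quad_multiples_uminus: "rpoly_subspace L \<Longrightarrow> p \<in> quad_multiples n L \<Longrightarrow> - p \<in> quad_multiples n L"
  using quad_multiples_Const_mult[of L p n "-1"] by (simp add: Const_uminus)

section \<open>Values of a pencil on sums of squares\<close>

locale pencil =
  fixes n a :: nat and M :: "nat \<Rightarrow> nat \<Rightarrow> rpoly"
  assumes symm: "symm_on a M"
    and linear: "\<And>i j. i < a \<Longrightarrow> j < a \<Longrightarrow> M i j \<in> rpolys_upto n 1"
begin

abbreviation V :: "rpoly set" where "V \<equiv> rpolys_upto n 1"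

text \<open>The elements are the traces tr(A P^T P) for matrices \<open>P\<close> with entries of
  degree at most 1, the list \<open>ws\<close> running through the rows of \<open>P\<close>. Lists
  of any length make the set closed under addition by concatenation.\<close>

definition sos_values :: "rpoly set"
  where "sos_values = {sum_list (map (\<lambda>w. bform a M w w) ws) | ws. \<forall>w\<in>set ws. \<forall>i. w i \<in> V}"

lemma sos_values_0: "0 \<in> sos_values"
  unfolding sos_values_def by (auto intro!: exI[of _ "[]"])

lemma sos_values_add: "p \<in> sos_values \<Longrightarrow> q \<in> sos_values \<Longrightarrow> p + q \<in> sos_values"
proof -
  assume "p \<in> sos_values" "q \<in> sos_values"
  then obtain vs ws where "p = sum_list (map (\<lambda>w. bform a M w w) vs)" "q = sum_list (map (\<lambda>w. bform a M w w) ws)"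
    "\<forall>w\<in>set vs. \<forall>i. w i \<in> V" "\<forall>w\<in>set ws. \<forall>i. w i \<in> V" by (auto simp: sos_values_def)
  then show ?thesis unfolding sos_values_def by (auto intro!: exI[of _ "vs @ ws"])
qed

lemma sos_values_bform: "(\<And>i. w i \<in> V) \<Longrightarrow> bform a M w w \<in> sos_values"
  unfolding sos_values_def by (auto intro!: exI[of _ "[w]"])

lemma sos_values_sum: "(\<And>i. i \<in> J \<Longrightarrow> g i \<in> sos_values) \<Longrightarrow> sum g J \<in> sos_values"
  by (induction J rule: infinite_finite_induct) (auto intro: sos_values_0 sos_values_add)

lemma sos_values_Const_mult:
  assumes "0 \<le> c" "p \<in> sos_values"
  shows "Const c * p \<in> sos_values"
proof -
  obtain ws where ws: "p = sum_list (map (\<lambda>w. bform a M w w) ws)" "\<forall>w\<in>set ws. \<forall>i. w i \<in> V"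
    using assms(2) by (auto simp: sos_values_def)
  have c: "Const c = Const (sqrt c) * Const (sqrt c)"
    using assms(1) by (simp flip: Const_mult)
  have "Const c * p = sum_list (map (\<lambda>w. Const c * bform a M w w) ws)"
    by (simp add: ws(1) sum_list_const_mult)
  also have "\<dots> = sum_list (map (\<lambda>w. bform a M w w) (map (\<lambda>w i. Const (sqrt c) * w i) ws))"
    by (simp add: o_def bform_mult_left bform_mult_right c mult.assoc)
  finally show ?thesis
    unfolding sos_values_def using ws(2)
    by (auto intro!: exI[of _ "map (\<lambda>w i. Const (sqrt c) * w i) ws"] rpolys_upto_Const_mult)
qed

section \<open>Chains of identities and their extension by one linear form\<close>

text \<open>
  \<open>w m\<close> is the row of \<open>W\<^sub>k\<close> with index \<open>m\<close>, read as a linear polynomial, and \<open>U\<^sub>k\<close> is always taken to be \<open>W\<^sub>k\<^sup>* W\<^sub>k\<close>.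
\<close>

primrec chain :: "nat \<Rightarrow> (monomial \<Rightarrow> rpoly) \<Rightarrow> bool"
  where "chain 0 w \<longleftrightarrow> (\<forall>m. w m = 0)"
  | "chain (Suc k) w \<longleftrightarrow> (\<forall>m. w m \<in> V) \<and> (\<exists>w' q. chain k w' \<and> q \<in> sos_values \<and>
      (\<Sum>m\<in>monomials n 2. (w m)\<^sup>2) + (\<Sum>m\<in>monomials n 2. X m * w' m) + q = 0)"

text \<open>A chain is padded at its beginning by a step in which everything is 0. This is how
  shorter reductions reach the prescribed length \<open>n\<close>.\<close>

lemma chain_Suc: "chain k w \<Longrightarrow> chain (Suc k) w"
proof (induction k arbitrary: w)
  case 0
  then show ?case by (auto intro!: exI[of _ "\<lambda>_. 0"] sos_values_0)
next
  case (Suc k)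
  from Suc.prems obtain w' q where "chain k w'" "\<forall>m. w m \<in> V" "q \<in> sos_values"
    "(\<Sum>m\<in>monomials n 2. (w m)\<^sup>2) + (\<Sum>m\<in>monomials n 2. X m * w' m) + q = 0" by auto
  then show ?case using Suc.IH[of w'] chain.simps(2)[of "Suc k" w] by blast
qed

lemma chain_mono: "chain k w \<Longrightarrow> k \<le> k' \<Longrightarrow> chain k' w"
  by (induction k' rule: nat_induct) (auto simp: le_Suc_eq intro: chain_Suc simp del: chain.simps)

lemma chain_extend:
  assumes L: "rpoly_subspace L" "L \<subseteq> V"
    and chain: "\<And>w. (\<And>m. w m \<in> L) \<Longrightarrow> chain k w"
    and l: "l \<in> V" "q \<in> sos_values" "z \<in> quad_multiples n L" "l\<^sup>2 + q + z = 0"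
    and w: "\<And>m. \<exists>s. w m - Const s * l \<in> L"
  shows "chain (Suc k) w"
proof -
  obtain s where s: "\<And>m. w m - Const (s m) * l \<in> L" using w by metis
  define p where "p m = w m - Const (s m) * l" for m
  have pL: "p m \<in> L" for m using s by (simp add: p_def)
  then have pV: "p m \<in> V" for m using L(2) by blast
  have w_eq: "w m = Const (s m) * l + p m" for m by (simp add: p_def)
  have wV: "w m \<in> V" for m
    using pV l(1) by (simp add: w_eq rpolys_upto_add rpolys_upto_Const_mult)
  define t where "t = (\<Sum>m\<in>monomials n 2. (s m)\<^sup>2)"
  \<comment> \<open>With \<open>w m = s l + p\<close> one has (s l + p)^2 - s^2 l^2 = (2 s l + p) p
    = (s l + w) p. The factor 1 raises the degree bound of the cofactor from 1 to 2.\<close>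
  define z' where "z' = (\<Sum>m\<in>monomials n 2. (1 * (Const (s m) * l + w m)) * p m)"
  have "1 * (Const (s m) * l + w m) \<in> rpolys_upto n (1 + 1)" for m
    using wV l(1) by (intro rpolys_upto_mult) (simp_all add: rpolys_upto_add rpolys_upto_Const_mult)
  then have z': "z' \<in> quad_multiples n L"
    unfolding z'_def using pL L(1)
    by (intro quad_multiples_sum quad_multiples_mult) (simp_all add: numeral_2_eq_2)
  have "(w m)\<^sup>2 = Const ((s m)\<^sup>2) * l\<^sup>2 + (1 * (Const (s m) * l + w m)) * p m" for m
    unfolding w_eq by (simp add: power2_eq_square Const_mult algebra_simps)
  then have squares: "(\<Sum>m\<in>monomials n 2. (w m)\<^sup>2) = Const t * l\<^sup>2 + z'"
    by (simp add: t_def z'_def sum.distrib Const_sum sum_distrib_right)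
  have "- z' + Const t * z \<in> quad_multiples n L"
    using z' l(3) L(1) by (intro quad_multiples_add quad_multiples_uminus quad_multiples_Const_mult)
  \<comment> \<open>The preceding matrix cancels the remainder \<open>z'\<close> and supplies
    \<open>t z\<close>, so that \<open>t\<close> times the identity for \<open>l\<close> is
    left.\<close>
  then obtain w' where w': "- z' + Const t * z = (\<Sum>m\<in>monomials n 2. X m * w' m)" "\<forall>m. w' m \<in> L"
    by (auto simp: quad_multiples_def)
  have "Const t * l\<^sup>2 + z' + (- z' + Const t * z) + Const t * q = Const t * (l\<^sup>2 + q + z)"
    by (simp add: algebra_simps)
  then have "(\<Sum>m\<in>monomials n 2. (w m)\<^sup>2) + (\<Sum>m\<in>monomials n 2. X m * w' m) + Const t * q = 0"
    unfolding squares w'(1)[symmetric] l(4) by simp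
  moreover have "chain k w'" using w'(2) chain by blast
  moreover have "Const t * q \<in> sos_values"
    by (intro sos_values_Const_mult l) (simp add: t_def sum_nonneg)
  ultimately show ?thesis using wV by auto
qed

section \<open>Traces against constant matrices\<close>

text \<open>This is tr(A S), because the pencil is symmetric.\<close>

definition trp :: "(nat \<Rightarrow> nat \<Rightarrow> real) \<Rightarrow> rpoly"
  where "trp S = (\<Sum>i<a. \<Sum>j<a. M i j * Const (S i j))"

abbreviation cform :: "(nat \<Rightarrow> real) \<Rightarrow> (nat \<Rightarrow> real) \<Rightarrow> rpoly"
  where "cform u v \<equiv> bform a M (\<lambda>i. Const (u i)) (\<lambda>i. Const (v i))"

lemma cform_in_V: "cform u v \<in> V"
  unfolding bform_def
proof (intro rpolys_upto_sum)
  fix i j assume "i \<in> {..<a}" "j \<in> {..<a}"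
  then have "Const (u i * v j) * M i j \<in> V" using linear by (simp add: rpolys_upto_Const_mult)
  then show "M i j * Const (u i) * Const (v j) \<in> V" by (simp add: Const_mult ac_simps)
qed

lemma trp_gram:
  assumes "\<And>i j. i < a \<Longrightarrow> j < a \<Longrightarrow> S i j = (\<Sum>k<a. u k i * u k j)"
  shows "trp S = (\<Sum>k<a. cform (u k) (u k))"
proof -
  have "trp S = (\<Sum>i<a. \<Sum>j<a. \<Sum>k<a. M i j * Const (u k i) * Const (u k j))"
    unfolding trp_def using assms
    by (intro sum.cong refl) (simp add: Const_sum Const_mult sum_distrib_left mult.assoc)
  also have "\<dots> = (\<Sum>i<a. \<Sum>k<a. \<Sum>j<a. M i j * Const (u k i) * Const (u k j))"
    by (intro sum.cong refl sum.swap)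
  also have "\<dots> = (\<Sum>k<a. cform (u k) (u k))"
    unfolding bform_def by (rule sum.swap)
  finally show ?thesis .
qed

lemma trp_in_V: "trp S \<in> V"
  unfolding trp_def using linear
  by (intro rpolys_upto_sum) (metis lessThan_iff mult.commute rpolys_upto_Const_mult)

lemma trp_scale: "trp (\<lambda>i j. c * S i j) = Const c * trp S"
  by (simp add: trp_def Const_mult sum_distrib_left ac_simps)

lemma trp_psd_in_sos_values: "psd_on a S \<Longrightarrow> trp S \<in> sos_values"
  by (rule psd_on_gram) (auto simp: trp_gram intro!: sos_values_sum sos_values_bform)

text \<open>A witness is what \<open>chain_extend\<close> needs in order to enlarge \<open>L\<close>
  by \<open>l\<close>. If there is none, any identity of this shape forces its \<open>l\<close> into
  \<open>L\<close>.\<close>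

definition new_form :: "rpoly set \<Rightarrow> bool"
  where "new_form L \<longleftrightarrow> (\<exists>l q z. l \<in> V \<and> l \<notin> L \<and> q \<in> sos_values \<and> z \<in> quad_multiples n L \<and> l\<^sup>2 + q + z = 0)"

lemma new_formI:
  "\<lbrakk>l \<in> V; l \<notin> L; q \<in> sos_values; z \<in> quad_multiples n L; l\<^sup>2 + q + z = 0\<rbrakk> \<Longrightarrow> new_form L"
  unfolding new_form_def by blast

lemma rpolys_upto_square: "p \<in> V \<Longrightarrow> p * p \<in> rpolys_upto n 2"
  using rpolys_upto_mult[of p n 1 p 1] by (simp add: numeral_2_eq_2)

lemma Const_half: "2 * Const (1/2) = 1"
  using Const_add[of "1/2" "1/2"] by simp

section \<open>Spaces that admit no new form\<close>

context
  fixes L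
  assumes L: "rpoly_subspace L" "L \<subseteq> V" and one: "1 \<notin> L" and stuck: "\<not> new_form L"
begin

text \<open>For positive \<open>c\<close>, division by \<open>c\<close> puts 1 + tr(A S)/c into
  \<open>L\<close>, which makes 1 a new form.\<close>

lemma degenerate_constant:
  assumes "0 \<le> c" "psd_on a S" "Const c + trp S \<in> L"
  shows "c = 0"
proof (rule ccontr)
  assume "c \<noteq> 0"
  then have c: "c > 0" using assms(1) by simp
  let ?k = "Const (1/c)"
  have k: "?k * Const c = 1" using c by (simp flip: Const_mult)
  have "1 * (- (?k * (Const c + trp S))) \<in> quad_multiples n L"
    using L(1) assms(3) by (intro quad_multiples_mult rpoly_subspace_uminus) (auto intro: rpoly_subspaceD)
  moreover have "?k * trp S \<in> sos_values"
    using c assms(2) by (intro sos_values_Const_mult trp_psd_in_sos_values) auto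
  moreover have "1\<^sup>2 + ?k * trp S + 1 * (- (?k * (Const c + trp S))) = 0"
    using k by (simp add: distrib_left)
  ultimately show False using new_formI[OF rpolys_upto_1 one] stuck by blast
qed

text \<open>
  If \<open>p + p'\<close> vanishes modulo \<open>L\<close>, then \<open>((1 - p)/2)\<^sup>2 p + ((1 + p)/2)\<^sup>2 p'\<close> is \<open>- p\<^sup>2\<close> modulo
  the multiples of \<open>L\<close>.
\<close>

lemma degenerate_diagonal:
  fixes m :: nat
  assumes "(\<Sum>k<m. cform (u k) (u k)) \<in> L" "k < m"
  shows "cform (u k) (u k) \<in> L"
proof (rule ccontr)
  define p where "p = cform (u k) (u k)"
  define T where "T = (\<Sum>k<m. cform (u k) (u k))"
  define h1 h2 where "h1 = Const (1/2) * (1 - p)" and "h2 = Const (1/2) * (1 + p)"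
  assume "p \<notin> L"
  have pV: "p \<in> V" unfolding p_def by (rule cform_in_V)
  have hV: "h1 \<in> V" "h2 \<in> V" using pV
    by (auto simp: h1_def h2_def intro!: rpolys_upto_Const_mult rpolys_upto_add rpolys_upto_diff)
  have "h1 - h2 = - (2 * Const (1/2) * p)" "h1 + h2 = 2 * Const (1/2)"
    by (auto simp: h1_def h2_def algebra_simps)
  then have h: "h1 - h2 = - p" "h1 + h2 = 1" by (simp_all add: Const_half)
  have T: "T - p = (\<Sum>j\<in>{..<m} - {k}. cform (u j) (u j))"
    unfolding T_def p_def using assms(2) by (subst sum.remove[of "{..<m}" k]) auto
  have hform: "bform a M (\<lambda>i. h * Const (v i)) (\<lambda>i. h * Const (v i)) = h * h * cform v v" for h v
    by (simp add: bform_mult_left bform_mult_right ac_simps)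
  \<comment> \<open>For linear \<open>h\<close> and constant \<open>v\<close> the vector
    \<open>h v\<close> has linear entries, so it may serve as a row of a quadratic sum of
    squares.\<close>
  have hsos: "h * h * cform v v \<in> sos_values" if "h \<in> V" for h v
    unfolding hform[symmetric] using that
    by (intro sos_values_bform) (metis mult.commute rpolys_upto_Const_mult)
  have "h1 * h1 * p + h2 * h2 * (T - p) \<in> sos_values"
  proof (rule sos_values_add)
    show "h1 * h1 * p \<in> sos_values" unfolding p_def by (rule hsos[OF hV(1)])
    show "h2 * h2 * (T - p) \<in> sos_values"
      unfolding T sum_distrib_left by (intro sos_values_sum hsos hV(2))
  qed
  moreover have "h2 * h2 * (- T) \<in> quad_multiples n L"
    using L(1) assms(1) rpolys_upto_square[OF hV(2)]
    by (intro quad_multiples_mult rpoly_subspace_uminus) (auto simp: T_def)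
  moreover have "p\<^sup>2 + (h1 * h1 * p + h2 * h2 * (T - p)) + h2 * h2 * (- T) = p\<^sup>2 + p * ((h1 - h2) * (h1 + h2))"
    by (simp add: algebra_simps)
  then have "p\<^sup>2 + (h1 * h1 * p + h2 * h2 * (T - p)) + h2 * h2 * (- T) = 0"
    unfolding h by (simp add: power2_eq_square)
  ultimately show False using new_formI[OF pV \<open>p \<notin> L\<close>] stuck by blast
qed

text \<open>
  With \<open>q = v\<^sup>* A u\<close> and \<open>r = v\<^sup>* A v\<close>, the vector \<open>q v - (r + 1)/2 u\<close> has the value \<open>- q\<^sup>2\<close> modulo
  the multiples of \<open>L\<close>.
\<close>

lemma degenerate_kernel:
  assumes "cform u u \<in> L"
  shows "cform v u \<in> L"
proof (rule ccontr)
  define q r p s where "q = cform v u" and "r = cform v v" and "p = cform u u"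
    and "s = Const (1/2) * (- (r + 1))"
  assume "q \<notin> L"
  have V: "q \<in> V" "r \<in> V" unfolding q_def r_def by (rule cform_in_V)+
  then have sV: "s \<in> V" unfolding s_def
    by (intro rpolys_upto_Const_mult rpolys_upto_uminus rpolys_upto_add) auto
  have "r + 2 * s = r - (2 * Const (1/2)) * (r + 1)" by (simp add: s_def algebra_simps)
  then have rs: "r + 2 * s = - 1" by (simp add: Const_half)
  let ?w = "\<lambda>i. q * Const (v i) + s * Const (u i)"
  have "bform a M ?w ?w = q\<^sup>2 * r + 2 * q * s * q + s\<^sup>2 * p"
    by (simp add: bform_lincomb[OF symm] q_def r_def p_def)
  also have "\<dots> = q\<^sup>2 * (r + 2 * s) + s * s * p"
    by (simp add: power2_eq_square algebra_simps)
  finally have "q\<^sup>2 + bform a M ?w ?w + s * s * (- p) = 0" unfolding rs by simp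
  moreover have "bform a M ?w ?w \<in> sos_values"
    using V(1) sV by (intro sos_values_bform rpolys_upto_add) (metis mult.commute rpolys_upto_Const_mult)+
  moreover have "s * s * (- p) \<in> quad_multiples n L"
    using L(1) assms rpolys_upto_square[OF sV]
    by (intro quad_multiples_mult rpoly_subspace_uminus) (auto simp: p_def)
  ultimately show False using new_formI[OF V(1) \<open>q \<notin> L\<close>] stuck by blast
qed

text \<open>Together the three preceding lemmas say that \<open>c\<close> is 0 and A S is 0 modulo
  \<open>L\<close>: each Gram vector of \<open>S\<close> lies in the kernel of the pencil modulo
  \<open>L\<close>.\<close>

lemma degenerate_gram:
  assumes "0 \<le> c" "psd_on a S" "Const c + trp S \<in> L"
  obtains u where "c = 0" "\<And>i j. i < a \<Longrightarrow> j < a \<Longrightarrow> S i j = (\<Sum>k<a. u k i * u k j)"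
    "\<And>k v. k < a \<Longrightarrow> cform v (u k) \<in> L"
proof -
  obtain u where u: "\<And>i j. i < a \<Longrightarrow> j < a \<Longrightarrow> S i j = (\<Sum>k<a. u k i * u k j)"
    using psd_on_gram[OF assms(2)] by metis
  have c: "c = 0" using degenerate_constant[OF assms] .
  have "(\<Sum>k<a. cform (u k) (u k)) \<in> L" using assms(3) c trp_gram[OF u] by simp
  then show ?thesis using that[OF c u] degenerate_kernel degenerate_diagonal[of u a] by blast
qed

end

section \<open>Spaces cut out by functionals, and evaluation at a point\<close>

text \<open>The functionals serve as coordinates modulo \<open>L\<close>. Each reduction step
  discards one of the initial \<open>n + 1\<close> functionals, so counting them replaces an
  argument with dimensions.\<close>

definition common_kernel :: "monomial set \<Rightarrow> (monomial \<Rightarrow> rpoly \<Rightarrow> real) \<Rightarrow> rpoly set"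
  where "common_kernel I \<pi> = {p \<in> V. \<forall>m\<in>I. \<pi> m p = 0}"

lemma common_kernel_subspace:
  assumes "\<And>m. linear_functional (\<pi> m)"
  shows "rpoly_subspace (common_kernel I \<pi>)"
  unfolding rpoly_subspace_def common_kernel_def
  by (auto simp: linear_functionalD[OF assms] rpolys_upto_add rpolys_upto_Const_mult)

lemma functional_cform:
  assumes "linear_functional \<phi>"
  shows "\<phi> (cform u v) = bform a (\<lambda>i j. \<phi> (M i j)) u v"
proof -
  have "\<phi> (M i j * Const (u i) * Const (v j)) = \<phi> (M i j) * u i * v j" for i j
    using linear_functionalD(2)[OF assms, of "u i * v j" "M i j"] by (simp add: Const_mult ac_simps)
  then show ?thesis by (simp add: bform_def linear_functionalD(7)[OF assms])
qed

lemma functional_trp: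
  assumes "linear_functional \<phi>"
  shows "\<phi> (trp S) = (\<Sum>i<a. \<Sum>j<a. S i j * \<phi> (M i j))"
proof -
  have "\<phi> (M i j * Const (S i j)) = S i j * \<phi> (M i j)" for i j
    using linear_functionalD(2)[OF assms, of "S i j" "M i j"] by (simp add: ac_simps)
  then show ?thesis by (simp add: trp_def linear_functionalD(7)[OF assms])
qed

definition functional_point :: "(rpoly \<Rightarrow> real) \<Rightarrow> real vec"
  where "functional_point \<phi> = vec n (\<lambda>i. \<phi> (X (Poly_Mapping.single i 1)) / \<phi> 1)"

text \<open>A linear polynomial is a combination of 1 and the variables; so on \<open>V\<close> a
  functional that is nonzero at 1 is a scaled evaluation, at the point whose homogeneous coordinates
  are its values.\<close>

lemma functional_eval:
  assumes "linear_functional \<phi>" "\<phi> 1 \<noteq> 0" "p \<in> V"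
  shows "\<phi> p = \<phi> 1 * eval_rpoly (functional_point \<phi>) p"
proof -
  note p = rpolys_upto_1_expand[OF assms(3)]
  have mon: "eval_monomial (functional_point \<phi>) (Poly_Mapping.single i 1) = \<phi> (X (Poly_Mapping.single i 1)) / \<phi> 1"
    if "i < n" for i
    using that by (simp add: eval_monomial_def functional_point_def)
  have "\<phi> p = Poly_Mapping.lookup p 0 * \<phi> 1
      + (\<Sum>i<n. Poly_Mapping.lookup p (Poly_Mapping.single i 1) * \<phi> (X (Poly_Mapping.single i 1)))"
    by (subst p) (simp add: linear_functionalD[OF assms(1)])
  moreover have "eval_rpoly (functional_point \<phi>) p = Poly_Mapping.lookup p 0
      + (\<Sum>i<n. Poly_Mapping.lookup p (Poly_Mapping.single i 1) * (\<phi> (X (Poly_Mapping.single i 1)) / \<phi> 1))"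
    by (subst p) (use mon in \<open>simp add: eval_rpoly_add eval_rpoly_sum eval_rpoly_mult eval_rpoly_single\<close>)
  ultimately show ?thesis
    using assms(2) by (simp add: distrib_left sum_distrib_left mult.left_commute)
qed

definition nonneg_on_pencil :: "rpoly \<Rightarrow> bool"
  where "nonneg_on_pencil f \<longleftrightarrow>
    (\<forall>x\<in>carrier_vec n. psd_on a (\<lambda>i j. eval_rpoly x (M i j)) \<longrightarrow> 0 \<le> eval_rpoly x f)"

definition certified :: "rpoly set \<Rightarrow> rpoly \<Rightarrow> bool"
  where "certified L f \<longleftrightarrow> (\<exists>c S. 0 \<le> c \<and> psd_on a S \<and> f - Const c - trp S \<in> L)"

text \<open>Modulo \<open>L\<close> only the value at one point counts. If \<open>f\<close> is
  nonnegative there, a constant has the same value; otherwise the point is outside the spectrahedron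
  and a rank-one \<open>S\<close> makes tr(A S) negative there.\<close>

lemma certified_point:
  assumes \<phi>: "linear_functional \<phi>" "\<phi> 1 \<noteq> 0" and L: "\<And>p. p \<in> V \<Longrightarrow> \<phi> p = 0 \<Longrightarrow> p \<in> L"
    and f: "f \<in> V" "nonneg_on_pencil f"
  shows "certified L f"
proof -
  let ?x = "functional_point \<phi>"
  let ?E = "\<lambda>i j. eval_rpoly ?x (M i j)"
  have x: "?x \<in> carrier_vec n" by (simp add: functional_point_def)
  have main: "certified L f" if "0 \<le> c" "psd_on a S" "eval_rpoly ?x f = c + eval_rpoly ?x (trp S)" for c S
  proof -
    have "f - Const c - trp S \<in> V" by (intro rpolys_upto_diff f(1) trp_in_V rpolys_upto_Const)
    moreover have "\<phi> (f - Const c - trp S) = 0"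
      using that(3) functional_eval[OF \<phi> calculation] by (simp add: eval_rpoly_diff)
    ultimately show ?thesis using L that(1,2) unfolding certified_def by blast
  qed
  show ?thesis
  proof (cases "0 \<le> eval_rpoly ?x f")
    case True
    moreover have "trp (\<lambda>_ _. 0) = 0" by (simp add: trp_def)
    ultimately show ?thesis using main[of "eval_rpoly ?x f" "\<lambda>_ _. 0"]
      by (simp add: psd_on_def symm_on_def bform_def)
  next
    case False
    then have "\<not> psd_on a ?E" using f(2) x unfolding nonneg_on_pencil_def by blast
    moreover have "symm_on a ?E" using symm by (simp add: symm_on_def)
    ultimately obtain v where v: "bform a ?E v v < 0" by (auto simp: psd_on_def not_le)
    \<comment> \<open>A quotient of two negative numbers: it scales the matrix v v^T so that tr(A S)
      and \<open>f\<close> agree at the point.\<close>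
    define r where "r = eval_rpoly ?x f / bform a ?E v v"
    have r: "r > 0" using v False by (simp add: r_def divide_neg_neg)
    have "bform a (\<lambda>i j. r * v i * v j) u u = r * (\<Sum>i<a. v i * u i)\<^sup>2" for u
      by (simp add: bform_def power2_eq_square sum_product sum_distrib_left ac_simps)
    then have "psd_on a (\<lambda>i j. r * v i * v j)"
      using r by (simp add: psd_on_def symm_on_def)
    moreover have "eval_rpoly ?x (trp (\<lambda>i j. r * v i * v j)) = r * bform a ?E v v"
      by (simp add: trp_def bform_def eval_rpoly_sum eval_rpoly_mult sum_distrib_left ac_simps)
    then have "eval_rpoly ?x f = 0 + eval_rpoly ?x (trp (\<lambda>i j. r * v i * v j))"
      using v by (simp add: r_def)
    ultimately show ?thesis using main[of 0] by simp
  qed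
qed

section \<open>The alternative: a certificate modulo the space, or a new form\<close>

text \<open>The columns of the pencil indexed by \<open>J\<close> form a basis of its column space modulo \<open>L\<close>.\<close>

lemma column_basis:
  assumes L: "rpoly_subspace L"
  obtains J where "J \<subseteq> {..<a}"
    and "\<forall>u. (\<forall>i. i \<notin> J \<longrightarrow> u i = 0) \<longrightarrow> (\<forall>v. cform v u \<in> L) \<longrightarrow> u = (\<lambda>_. 0)"
    and "\<forall>u. \<exists>w. (\<forall>i. i \<notin> J \<longrightarrow> w i = 0) \<and> (\<forall>v. cform v (\<lambda>i. u i - w i) \<in> L)"
proof -
  define indep where "indep J \<longleftrightarrow> (\<forall>u. (\<forall>i. i \<notin> J \<longrightarrow> u i = 0) \<longrightarrow> (\<forall>v. cform v u \<in> L) \<longrightarrow> u = (\<lambda>_. 0))" for J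
  define C where "C = {J. J \<subseteq> {..<a} \<and> indep J}"
  have "finite C" unfolding C_def by (rule finite_subset[of _ "Pow {..<a}"]) auto
  moreover have "{} \<in> C" by (auto simp: C_def indep_def)
  then have "C \<noteq> {}" by blast
  ultimately obtain J where "J \<in> C" "\<And>J'. J' \<in> C \<Longrightarrow> J \<subseteq> J' \<Longrightarrow> J' = J"
    using finite_has_maximal[of C] by metis
  then have J: "J \<subseteq> {..<a}" "indep J"
    and max: "\<And>J'. \<lbrakk>J' \<subseteq> {..<a}; indep J'; J \<subseteq> J'\<rbrakk> \<Longrightarrow> J' = J"
    by (auto simp: C_def)
  \<comment> \<open>By maximality of \<open>J\<close>, adding \<open>i\<close> creates a dependency,
    whose entry at \<open>i\<close> is nonzero because \<open>J\<close> is independent.\<close>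
  have ex: "\<exists>u. (\<forall>k. k \<notin> insert i J \<longrightarrow> u k = 0) \<and> (\<forall>v. cform v u \<in> L) \<and> u i \<noteq> 0" if i: "i < a" "i \<notin> J" for i
  proof -
    have "\<not> indep (insert i J)" using max[of "insert i J"] i J(1) by auto
    then obtain u where u: "\<forall>k. k \<notin> insert i J \<longrightarrow> u k = 0" "\<forall>v. cform v u \<in> L" "u \<noteq> (\<lambda>_. 0)"
      by (auto simp: indep_def)
    moreover have "u i \<noteq> 0"
    proof
      assume "u i = 0"
      then have "\<forall>k. k \<notin> J \<longrightarrow> u k = 0" using u(1) by (metis insertE)
      then show False using J(2) u(2,3) unfolding indep_def by blast
    qed
    ultimately show ?thesis by blast
  qed
  \<comment> \<open>The indices outside \<open>J\<close> are eliminated one at a time. The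
    dependency for \<open>i\<close> is supported on \<open>insert i J\<close>, so subtracting it
    does not bring back an index removed before.\<close>
  have elim: "\<exists>w. (\<forall>i. i \<notin> {..<a} - K \<longrightarrow> w i = 0) \<and> (\<forall>v. cform v (\<lambda>i. u i - w i) \<in> L)"
    if "finite K" "K \<subseteq> {..<a} - J" for K u
    using that
  proof (induction K)
    case empty
    \<comment> \<open>The form reads only indices below \<open>a\<close>, so the entries beyond can
      be reset to 0.\<close>
    have "cform v (\<lambda>i. u i - (if i < a then u i else 0)) = 0" for v
      by (simp add: bform_def)
    then show ?case using rpoly_subspaceD(1)[OF L]
      by (intro exI[of _ "\<lambda>i. if i < a then u i else 0"]) auto
  next
    case (insert i K)
    then obtain w where w: "\<forall>i. i \<notin> {..<a} - K \<longrightarrow> w i = 0" "\<forall>v. cform v (\<lambda>i. u i - w i) \<in> L" by auto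
    obtain b where b: "\<forall>k. k \<notin> insert i J \<longrightarrow> b k = 0" "\<forall>v. cform v b \<in> L" "b i \<noteq> 0"
      using ex[of i] insert.prems by auto
    define s where "s = w i / b i"
    have "cform v (\<lambda>k. u k - (w k - s * b k)) = cform v (\<lambda>k. u k - w k) + Const s * cform v b" for v
    proof -
      have "(\<lambda>k. Const (u k - (w k - s * b k))) = (\<lambda>k. Const (u k - w k) + Const s * Const (b k))"
        by (auto simp: Const_add Const_diff Const_mult algebra_simps)
      then show ?thesis by (simp only: bform_add_right bform_mult_right)
    qed
    then have "\<forall>v. cform v (\<lambda>k. u k - (w k - s * b k)) \<in> L"
      using w(2) b(2) rpoly_subspaceD[OF L] by simp
    moreover have "w k - s * b k = 0" if "k \<notin> {..<a} - insert i K" for k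
    proof (cases "k = i")
      case True
      then show ?thesis using b(3) by (simp add: s_def)
    next
      case False
      then have "k \<notin> {..<a} - K" "k \<notin> insert i J" using that insert.prems J(1) by auto
      then show ?thesis using w(1) b(1) by simp
    qed
    ultimately show ?case by (intro exI[of _ "\<lambda>k. w k - s * b k"]) auto
  qed
  have "{..<a} - ({..<a} - J) = J" using J(1) by blast
  then have "\<exists>w. (\<forall>i. i \<notin> J \<longrightarrow> w i = 0) \<and> (\<forall>v. cform v (\<lambda>i. u i - w i) \<in> L)" for u
    using elim[of "{..<a} - J" u] by simp
  then show ?thesis using that[OF J(1)] J(2) unfolding indep_def by blast
qed

text \<open>The normalization of the slice supplies compactness. A zero modulo \<open>L\<close> with
  positive \<open>t\<close> is a certificate after division by \<open>t\<close>; one with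
  \<open>t = 0\<close> is excluded by the absence of a new form.\<close>

lemma certified_or_new_form:
  assumes \<pi>: "\<And>m. linear_functional (\<pi> m)" and I: "finite I"
    and one: "1 \<notin> common_kernel I \<pi>" and f: "f \<in> V" "nonneg_on_pencil f"
    and stuck: "\<not> new_form (common_kernel I \<pi>)"
  shows "certified (common_kernel I \<pi>) f"
proof -
  define L where "L = common_kernel I \<pi>"
  have L: "rpoly_subspace L" "L \<subseteq> V"
    unfolding L_def by (rule common_kernel_subspace[OF \<pi>]) (auto simp: common_kernel_def)
  note stuck = one[folded L_def] stuck[folded L_def]
  obtain J where J: "J \<subseteq> {..<a}"
    and J_indep: "\<forall>u. (\<forall>i. i \<notin> J \<longrightarrow> u i = 0) \<longrightarrow> (\<forall>v. cform v u \<in> L) \<longrightarrow> u = (\<lambda>_. 0)"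
    and J_span: "\<forall>u. \<exists>w. (\<forall>i. i \<notin> J \<longrightarrow> w i = 0) \<and> (\<forall>v. cform v (\<lambda>i. u i - w i) \<in> L)"
    by (rule column_basis[OF L(1)])
  define comb where "comb = (\<lambda>(c, S, t). Const c + trp S - Const t * f)"
  have combV: "comb x \<in> V" for x
    unfolding comb_def using trp_in_V f(1)
    by (cases x) (auto intro!: rpolys_upto_add rpolys_upto_diff rpolys_upto_Const_mult)
  \<comment> \<open>The coordinates of \<open>comb x\<close> modulo \<open>L\<close>: since
    \<open>comb x\<close> is linear, it lies in \<open>L\<close> exactly if all coordinates in
    \<open>I\<close> vanish.\<close>
  define \<Phi> where "\<Phi> = (\<lambda>x m. \<pi> m (comb x))"
  have \<Phi>: "\<Phi> x m = fst x * \<pi> m 1 + (\<Sum>i<a. \<Sum>j<a. fst (snd x) i j * \<pi> m (M i j)) - snd (snd x) * \<pi> m f" for x m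
    by (cases x) (simp add: \<Phi>_def comb_def linear_functionalD[OF \<pi>] functional_trp[OF \<pi>])
  have scaled: "certified L f" if x: "(c, S, t) \<in> psd_slice a J" "comb (c, S, t) \<in> L" "t \<noteq> 0" for c S t
  proof -
    have t: "t > 0" "0 \<le> c" and S: "psd_on a S"
      using x(1,3) by (auto simp: psd_slice_def psd_on_def symm_on_def)
    have k: "Const (1/t) * Const t = 1" using t(1) by (simp flip: Const_mult)
    have "bform a (\<lambda>i j. 1/t * S i j) v v = 1/t * bform a S v v" for v
      unfolding bform_def by (simp add: sum_distrib_left)
    then have "psd_on a (\<lambda>i j. 1/t * S i j)"
      using S t(1) by (auto simp: psd_on_def symm_on_def)
    moreover have "f - Const (1/t * c) - trp (\<lambda>i j. 1/t * S i j) = - (Const (1/t) * comb (c, S, t))"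
    proof -
      have "Const (1/t) * comb (c, S, t) = Const (1/t) * Const c + Const (1/t) * trp S - (Const (1/t) * Const t) * f"
        by (simp only: comb_def split right_diff_distrib distrib_left mult.assoc)
      then show ?thesis unfolding trp_scale Const_mult k by simp
    qed
    then have "f - Const (1/t * c) - trp (\<lambda>i j. 1/t * S i j) \<in> L"
      using rpoly_subspace_uminus[OF L(1)] rpoly_subspaceD(3)[OF L(1) x(2)] by metis
    moreover have "0 \<le> 1/t * c" using t by simp
    ultimately show ?thesis unfolding certified_def by blast
  qed
  \<comment> \<open>The Gram vectors of \<open>S\<close> lie in the kernel modulo \<open>L\<close>
    and are supported on the column basis \<open>J\<close>, so they vanish. Then \<open>c\<close>
    and the trace of \<open>S\<close> are 0, against the normalization.\<close>
  have degenerate: False if x: "(c, S, 0) \<in> psd_slice a J" "comb (c, S, 0) \<in> L" for c S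
  proof -
    have S: "0 \<le> c" "psd_on a S" "Const c + trp S \<in> L"
      using x by (auto simp: psd_slice_def psd_on_def symm_on_def comb_def)
    obtain u where c: "c = 0" and u: "\<And>i j. i < a \<Longrightarrow> j < a \<Longrightarrow> S i j = (\<Sum>k<a. u k i * u k j)"
      "\<And>k v. k < a \<Longrightarrow> cform v (u k) \<in> L"
      by (rule degenerate_gram[OF L stuck S]) metis
    have uz: "u k i = 0" if k: "k < a" and i: "i < a" for k i
    proof -
      \<comment> \<open>Gram vectors are undetermined from \<open>a\<close> on, whereas
        \<open>J_indep\<close> asks for zeros at all indices outside \<open>J\<close>.\<close>
      define u' where "u' i = (if i < a then u k i else 0)" for i
      have "cform v u' = cform v (u k)" for v
        unfolding bform_def by (intro sum.cong refl) (simp add: u'_def)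
      moreover have "u' i = 0" if "i \<notin> J" for i
      proof (cases "i < a")
        case True
        have "S i i = 0" using x(1) that unfolding psd_slice_def by blast
        then have "(\<Sum>k<a. (u k i)\<^sup>2) = 0" using u(1)[OF True True] by (simp add: power2_eq_square)
        then show ?thesis using k by (simp add: u'_def sum_nonneg_eq_0_iff)
      qed (simp add: u'_def)
      ultimately have "u' = (\<lambda>_. 0)" using J_indep u(2)[OF k] by simp
      then show ?thesis using i by (metis u'_def)
    qed
    have "(\<Sum>i<a. S i i) = 0" using u(1) uz by simp
    then show False using x(1) c by (simp add: psd_slice_def)
  qed
  show ?thesis
  proof (cases "\<exists>x\<in>psd_slice a J. comb x \<in> L")
    case True
    then obtain c S t where "(c, S, t) \<in> psd_slice a J" "comb (c, S, t) \<in> L" by (metis prod_cases3)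
    then show ?thesis using scaled degenerate unfolding L_def by (cases "t = 0") blast+
  next
    case False
    have "continuous_on (psd_slice a J) \<Phi>"
      by (intro continuous_on_coordinatewise_then_product)
        (unfold \<Phi>, intro continuous_on_diff continuous_on_sum continuous_on_add continuous_on_mult
          continuous_on_const continuous_on_matrix_entry continuous_on_fst continuous_on_snd continuous_on_id)
    then have cpt: "compact (\<Phi> ` psd_slice a J)"
      using compact_psd_slice[OF J] by (rule compact_continuous_image)
    \<comment> \<open>The elements 1 and - f: besides showing that the slice is nonempty, they later
      fix the signs of the separating functional at 1 and at \<open>f\<close>.\<close>
    have base: "(1, \<lambda>_ _. 0, 0) \<in> psd_slice a J" "(0, \<lambda>_ _. 0, 1) \<in> psd_slice a J"
      by (auto simp: psd_slice_def bform_def)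
    then have ne: "\<Phi> ` psd_slice a J \<noteq> {}" by blast
    have conv: "(\<lambda>m. (1 - r) * y m + r * z m) \<in> \<Phi> ` psd_slice a J"
      if yz: "y \<in> \<Phi> ` psd_slice a J" "z \<in> \<Phi> ` psd_slice a J" "0 \<le> r" "r \<le> 1" for y z r
    proof -
      obtain x x' where "x \<in> psd_slice a J" "y = \<Phi> x" "x' \<in> psd_slice a J" "z = \<Phi> x'"
        using yz(1,2) by blast
      moreover obtain c S t c' S' t' where "x = (c, S, t)" "x' = (c', S', t')"
        by (cases x, cases x') auto
      ultimately have
        x: "(c, S, t) \<in> psd_slice a J" "y = \<Phi> (c, S, t)" "(c', S', t') \<in> psd_slice a J" "z = \<Phi> (c', S', t')"
        by auto
      have "(1 - r) * y m + r * z m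
          = \<Phi> ((1 - r) * c + r * c', (\<lambda>i j. (1 - r) * S i j + r * S' i j), (1 - r) * t + r * t') m" for m
      proof -
        have "(\<Sum>i<a. \<Sum>j<a. ((1 - r) * S i j + r * S' i j) * \<pi> m (M i j))
          = (1 - r) * (\<Sum>i<a. \<Sum>j<a. S i j * \<pi> m (M i j)) + r * (\<Sum>i<a. \<Sum>j<a. S' i j * \<pi> m (M i j))"
          unfolding sum_distrib_left sum.distrib[symmetric] by (intro sum.cong refl) (simp add: algebra_simps)
        then show ?thesis unfolding x(2,4) \<Phi> fst_conv snd_conv by (simp add: algebra_simps)
      qed
      then have "(\<lambda>m. (1 - r) * y m + r * z m)
          = \<Phi> ((1 - r) * c + r * c', (\<lambda>i j. (1 - r) * S i j + r * S' i j), (1 - r) * t + r * t')"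
        by blast
      then show ?thesis using psd_slice_convex[OF x(1,3) yz(3,4)] by blast
    qed
    have "\<exists>m\<in>I. y m \<noteq> 0" if "y \<in> \<Phi> ` psd_slice a J" for y
      using that False combV unfolding L_def common_kernel_def \<Phi>_def by auto
    then have "\<exists>y. \<forall>z\<in>\<Phi> ` psd_slice a J. 0 < (\<Sum>m\<in>I. y m * z m)"
      using conv by (intro min_norm_separation[OF cpt ne I] ballI) simp_all
    then obtain y where y: "\<forall>z\<in>\<Phi> ` psd_slice a J. 0 < (\<Sum>m\<in>I. y m * z m)" by blast
    define \<phi> where "\<phi> p = (\<Sum>m\<in>I. y m * \<pi> m p)" for p
    have \<phi>: "linear_functional \<phi>" unfolding \<phi>_def by (intro linear_functional_combination \<pi>)
    have \<phi>L: "\<phi> p = 0" if "p \<in> L" for p using that by (simp add: \<phi>_def L_def common_kernel_def)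
    have pos: "0 < \<phi> (comb x)" if "x \<in> psd_slice a J" for x
      using y that by (simp add: \<phi>_def \<Phi>_def)
    have trp0: "trp (\<lambda>_ _. 0) = 0" by (simp add: trp_def)
    have \<phi>1: "\<phi> 1 > 0" using pos[OF base(1)] by (simp add: comb_def trp0)
    have \<phi>f: "\<phi> f < 0" using pos[OF base(2)] by (simp add: comb_def trp0 linear_functionalD[OF \<phi>])
    let ?B = "\<lambda>i j. \<phi> (M i j)"
    have nonneg_J: "0 \<le> bform a ?B w w" if w: "\<And>i. i \<notin> J \<Longrightarrow> w i = 0" for w
    proof (cases "(\<Sum>i<a. (w i)\<^sup>2) = 0")
      case True
      then have "\<forall>i<a. w i = 0" by (simp add: sum_nonneg_eq_0_iff)
      then show ?thesis by (simp add: bform_def)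
    next
      case False
      define N where "N = (\<Sum>i<a. (w i)\<^sup>2)"
      have N: "N > 0" using False by (simp add: N_def sum_nonneg order_le_neq_trans)
      \<comment> \<open>Rank-one matrices of trace 1 lie in the slice and test the form in direction
        \<open>w\<close>.\<close>
      let ?S = "\<lambda>i j. w i * w j / N"
      have "bform a ?S v v = (\<Sum>i<a. w i * v i)\<^sup>2 / N" for v
        by (simp add: bform_def power2_eq_square sum_product sum_divide_distrib ac_simps)
      then have "(0, ?S, 0) \<in> psd_slice a J"
        using N w by (auto simp: psd_slice_def simp flip: sum_divide_distrib power2_eq_square N_def)
      from pos[OF this] have "0 < (\<Sum>i<a. \<Sum>j<a. ?S i j * ?B i j)"
        by (simp add: comb_def functional_trp[OF \<phi>])
      also have "\<dots> = bform a ?B w w / N"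
        by (simp add: bform_def sum_divide_distrib ac_simps)
      finally show ?thesis using N by (simp add: zero_less_divide_iff)
    qed
    have symB: "symm_on a ?B" using symm by (simp add: symm_on_def)
    \<comment> \<open>An arbitrary \<open>v\<close> differs from some \<open>w\<close> supported on
      \<open>J\<close> by a kernel vector modulo \<open>L\<close>. The functional vanishes on
      \<open>L\<close>, so both give the same value.\<close>
    have nonneg: "0 \<le> bform a ?B v v" for v
    proof -
      obtain w where w: "\<forall>i. i \<notin> J \<longrightarrow> w i = 0" "\<forall>x. cform x (\<lambda>i. v i - w i) \<in> L"
        using J_span by blast
      define d where "d i = v i - w i" for i
      have z: "bform a ?B x d = 0" for x
        using w(2) \<phi>L functional_cform[OF \<phi>, of x d] by (simp add: d_def)
      have "v = (\<lambda>i. 1 * w i + 1 * d i)" by (auto simp: d_def)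
      then have "bform a ?B v v = bform a ?B w w"
        using bform_lincomb[OF symB, of 1 w 1 d] z by simp
      then show ?thesis using nonneg_J w(1) by simp
    qed
    \<comment> \<open>Division by the positive value at 1 turns the functional into evaluation at a
      point of the spectrahedron, where \<open>f\<close> is negative: a contradiction.\<close>
    let ?x = "functional_point \<phi>"
    have eval: "eval_rpoly ?x p = \<phi> p / \<phi> 1" if "p \<in> V" for p
      using functional_eval[OF \<phi> _ that] \<phi>1 by simp
    have "bform a (\<lambda>i j. eval_rpoly ?x (M i j)) v v = bform a ?B v v / \<phi> 1" for v
      unfolding bform_def sum_divide_distrib by (intro sum.cong refl) (simp add: eval linear del: One_nat_def)
    then have "psd_on a (\<lambda>i j. eval_rpoly ?x (M i j))"
      using nonneg \<phi>1 symm by (simp add: psd_on_def symm_on_def)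
    then have "0 \<le> eval_rpoly ?x f"
      using f(2) unfolding nonneg_on_pencil_def by (simp add: functional_point_def)
    then show ?thesis using eval[OF f(1)] \<phi>1 \<phi>f by (simp add: zero_le_divide_iff)
  qed
qed

section \<open>Iterating the reduction\<close>

text \<open>The last matrix absorbs - r l, a quadratic multiple of \<open>L\<close>. Two cases are
  used: \<open>r\<close> is 1 and \<open>l\<close> is the defect of a certificate modulo
  \<open>L\<close>, or \<open>l\<close> is 1 and \<open>r\<close> is \<open>f\<close>
  itself.\<close>

lemma chain_imp_certificate:
  assumes L: "rpoly_subspace L" and chain: "\<And>w. (\<And>m. w m \<in> L) \<Longrightarrow> chain n w"
    and c: "0 \<le> c" "psd_on a S" and l: "r * l = f - Const c - trp S" "r \<in> rpolys_upto n 2" "l \<in> L"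
  shows "\<exists>c S w. 0 \<le> c \<and> psd_on a S \<and> chain n w \<and>
    f - Const c + (\<Sum>m\<in>monomials n 2. X m * w m) - trp S = 0"
proof -
  have "- (r * l) \<in> quad_multiples n L"
    by (intro quad_multiples_uminus quad_multiples_mult L l)
  then obtain w where "- (r * l) = (\<Sum>m\<in>monomials n 2. X m * w m)" "\<forall>m. w m \<in> L"
    by (auto simp: quad_multiples_def)
  then have "f - Const c + (\<Sum>m\<in>monomials n 2. X m * w m) - trp S = 0" "chain n w"
    using l(1) chain by (simp_all flip: \<open>- (r * l) = _\<close>)
  then show ?thesis using c by blast
qed

text \<open>Without a certificate the reduction cannot stop early: as long as the space contains
  neither 1 nor a certificate defect of \<open>f\<close>, \<open>certified_or_new_form\<close>
  provides another form.\<close>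

lemma facial_reduction:
  assumes f: "f \<in> V" "nonneg_on_pencil f" and "k \<le> n"
    and no_certificate: "\<nexists>c S w. 0 \<le> c \<and> psd_on a S \<and> chain n w \<and>
      f - Const c + (\<Sum>m\<in>monomials n 2. X m * w m) - trp S = 0"
  shows "\<exists>I \<pi>. finite I \<and> card I = n + 1 - k \<and> (\<forall>m. linear_functional (\<pi> m)) \<and>
    1 \<notin> common_kernel I \<pi> \<and> \<not> certified (common_kernel I \<pi>) f \<and>
    (\<forall>w. (\<forall>m. w m \<in> common_kernel I \<pi>) \<longrightarrow> chain k w)"
proof -
  have stop: "1 \<notin> common_kernel I \<pi> \<and> \<not> certified (common_kernel I \<pi>) f"
    if \<pi>: "\<forall>m. linear_functional (\<pi> m)" and k: "k \<le> n"
      and w: "\<forall>w. (\<forall>m. w m \<in> common_kernel I \<pi>) \<longrightarrow> chain k w" for I \<pi> k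
  proof -
    let ?L = "common_kernel I \<pi>"
    have L: "rpoly_subspace ?L" using common_kernel_subspace[of \<pi>] \<pi> by blast
    have chain_n: "chain n w" if "\<And>m. w m \<in> ?L" for w
      using chain_mono[OF _ k] w that by blast
    note certificate = chain_imp_certificate[OF L chain_n]
    have "1 \<notin> ?L"
    proof
      assume "1 \<in> ?L"
      moreover have "psd_on a (\<lambda>_ _. 0)" by (simp add: psd_on_def symm_on_def bform_def)
      moreover have "f * 1 = f - Const 0 - trp (\<lambda>_ _. 0)" by (simp add: trp_def)
      moreover have "f \<in> rpolys_upto n 2" using f(1) by (fastforce simp: rpolys_upto_def)
      ultimately show False using certificate[of 0 "\<lambda>_ _. 0" f 1 f] no_certificate by blast
    qed
    moreover have "\<not> certified ?L f"
    proof
      assume "certified ?L f"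
      then obtain c S where "0 \<le> c" "psd_on a S" "f - Const c - trp S \<in> ?L"
        by (auto simp: certified_def)
      then show False
        using certificate[of c S 1 "f - Const c - trp S" f] no_certificate by simp
    qed
    ultimately show ?thesis ..
  qed
  show ?thesis
    using \<open>k \<le> n\<close>
  proof (induction k)
    case 0
    \<comment> \<open>The reduction starts at the zero space, the common kernel in \<open>V\<close>
      of all \<open>n + 1\<close> coefficient functionals.\<close>
    define \<pi> :: "monomial \<Rightarrow> rpoly \<Rightarrow> real" where "\<pi> m p = Poly_Mapping.lookup p m" for m p
    have \<pi>: "linear_functional (\<pi> m)" for m
      by (auto simp: linear_functional_def \<pi>_def lookup_add lookup_Const_mult)
    have "chain 0 w" if "\<forall>m. w m \<in> common_kernel (monomials n 1) \<pi>" for w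
    proof -
      have "w m = 0" for m
      proof (rule poly_mapping_eqI)
        fix k
        have "w m \<in> V" and zero: "\<forall>k\<in>monomials n 1. Poly_Mapping.lookup (w m) k = 0"
          using that unfolding common_kernel_def \<pi>_def by blast+
        then have "Poly_Mapping.lookup (w m) k = 0"
          unfolding rpolys_upto_lookup by blast
        then show "Poly_Mapping.lookup (w m) k = Poly_Mapping.lookup 0 k" by simp
      qed
      then show ?thesis by simp
    qed
    then have w: "\<forall>w. (\<forall>m. w m \<in> common_kernel (monomials n 1) \<pi>) \<longrightarrow> chain 0 w" by blast
    have "finite (monomials n 1)" by (rule finite_monomials)
    moreover have "card (monomials n 1) = n + 1 - 0" using card_monomials_1 by simp
    moreover have "1 \<notin> common_kernel (monomials n 1) \<pi> \<and> \<not> certified (common_kernel (monomials n 1) \<pi>) f"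
      using \<pi> by (intro stop[OF _ _ w]) auto
    ultimately show ?case using \<pi> w by blast
  next
    case (Suc k)
    then obtain I \<pi> where I: "finite I" "card I = n + 1 - k" and \<pi>: "\<And>m. linear_functional (\<pi> m)"
      and one: "1 \<notin> common_kernel I \<pi>" and uncertified: "\<not> certified (common_kernel I \<pi>) f"
      and w: "\<And>w. (\<And>m. w m \<in> common_kernel I \<pi>) \<Longrightarrow> chain k w" by auto
    have L: "rpoly_subspace (common_kernel I \<pi>)" "common_kernel I \<pi> \<subseteq> V"
      by (rule common_kernel_subspace[OF \<pi>]) (auto simp: common_kernel_def)
    have "new_form (common_kernel I \<pi>)"
      using certified_or_new_form[OF \<pi> I(1) one f] uncertified by blast
    then obtain l q z where l: "l \<in> V" "q \<in> sos_values" "z \<in> quad_multiples n (common_kernel I \<pi>)" "l\<^sup>2 + q + z = 0"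
      and "l \<notin> common_kernel I \<pi>" by (auto simp: new_form_def)
    then obtain j where j: "j \<in> I" "\<pi> j l \<noteq> 0" by (auto simp: common_kernel_def)
    define \<pi>' where "\<pi>' m p = \<pi> m p - \<pi> j p / \<pi> j l * \<pi> m l" for m p
    have \<pi>': "linear_functional (\<pi>' m)" for m
      unfolding linear_functional_def \<pi>'_def linear_functionalD(1,2)[OF \<pi>]
      by (simp add: add_divide_distrib algebra_simps)
    have "chain (Suc k) w" if kernel: "\<forall>m. w m \<in> common_kernel (I - {j}) \<pi>'" for w
    proof (rule chain_extend[OF L w l])
      fix m
      define s where "s = \<pi> j (w m) / \<pi> j l"
      have "w m - Const s * l \<in> V"
        using kernel l(1) by (auto simp: common_kernel_def intro!: rpolys_upto_diff rpolys_upto_Const_mult)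
      moreover have "\<pi> i (w m - Const s * l) = 0" if "i \<in> I" for i
      proof (cases "i = j")
        case True
        then show ?thesis using j(2) by (simp add: s_def linear_functionalD(2,5)[OF \<pi>])
      next
        case False
        then have "\<pi>' i (w m) = 0" using kernel that by (simp add: common_kernel_def)
        then show ?thesis by (simp add: \<pi>'_def s_def linear_functionalD(2,5)[OF \<pi>])
      qed
      ultimately show "\<exists>s. w m - Const s * l \<in> common_kernel I \<pi>"
        unfolding common_kernel_def by blast
    qed
    then have w': "\<forall>w. (\<forall>m. w m \<in> common_kernel (I - {j}) \<pi>') \<longrightarrow> chain (Suc k) w" by blast
    have "finite (I - {j})" "card (I - {j}) = n + 1 - Suc k" using I j(1) by auto
    moreover have "1 \<notin> common_kernel (I - {j}) \<pi>' \<and> \<not> certified (common_kernel (I - {j}) \<pi>') f"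
      using \<pi>' by (intro stop[OF _ Suc.prems w']) auto
    ultimately show ?case using \<pi>' w' by blast
  qed
qed

text \<open>After \<open>n\<close> steps a single functional is left. It is nonzero at 1, so
  \<open>certified_point\<close> applies and contradicts the outcome of the reduction.\<close>

lemma certificate_exists:
  assumes f: "f \<in> V" "nonneg_on_pencil f"
  shows "\<exists>c S w. 0 \<le> c \<and> psd_on a S \<and> chain n w \<and>
    f - Const c + (\<Sum>m\<in>monomials n 2. X m * w m) - trp S = 0"
proof (rule ccontr)
  assume no_certificate: "\<not> ?thesis"
  obtain I \<pi> where "card I = n + 1 - n" and \<pi>: "\<And>m. linear_functional (\<pi> m)"
    and one: "1 \<notin> common_kernel I \<pi>" and uncertified: "\<not> certified (common_kernel I \<pi>) f"
    using facial_reduction[OF f order_refl no_certificate] by blast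
  then obtain m where I: "I = {m}" by (auto simp: card_1_singleton_iff)
  have "certified (common_kernel I \<pi>) f"
  proof (rule certified_point[OF \<pi>[of m] _ _ f])
    show "\<pi> m 1 \<noteq> 0" using one unfolding common_kernel_def I by auto
    show "p \<in> common_kernel I \<pi>" if "p \<in> V" "\<pi> m p = 0" for p
      using that unfolding common_kernel_def I by auto
  qed
  then show False using uncertified by contradiction
qed

text \<open>Unrolls the nested existentials of a chain into families indexed by the step.\<close>

lemma chain_sequence:
  "chain k w \<Longrightarrow> \<exists>ws qs. (\<forall>m. ws 0 m = 0) \<and> ws k = w \<and> (\<forall>i\<in>{1..k}. (\<forall>m. ws i m \<in> V) \<and> qs i \<in> sos_values \<and>
    (\<Sum>m\<in>monomials n 2. (ws i m)\<^sup>2) + (\<Sum>m\<in>monomials n 2. X m * ws (i - 1) m) + qs i = 0)"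
proof (induction k arbitrary: w)
  case 0
  then show ?case by (intro exI[of _ "\<lambda>_. w"]) auto
next
  case (Suc k)
  then obtain w' q where w: "chain k w'" "\<forall>m. w m \<in> V" "q \<in> sos_values"
    "(\<Sum>m\<in>monomials n 2. (w m)\<^sup>2) + (\<Sum>m\<in>monomials n 2. X m * w' m) + q = 0" by auto
  from Suc.IH[OF w(1)] obtain ws qs where ws: "\<forall>m. ws 0 m = 0" "ws k = w'"
    "\<forall>i\<in>{1..k}. (\<forall>m. ws i m \<in> V) \<and> qs i \<in> sos_values \<and>
      (\<Sum>m\<in>monomials n 2. (ws i m)\<^sup>2) + (\<Sum>m\<in>monomials n 2. X m * ws (i - 1) m) + qs i = 0" by blast
  have "\<forall>i\<in>{1..Suc k}. (\<forall>m. (ws(Suc k := w)) i m \<in> V) \<and> (qs(Suc k := q)) i \<in> sos_values \<and>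
      (\<Sum>m\<in>monomials n 2. ((ws(Suc k := w)) i m)\<^sup>2) +
      (\<Sum>m\<in>monomials n 2. X m * (ws(Suc k := w)) (i - 1) m) + (qs(Suc k := q)) i = 0"
  proof
    fix i assume i: "i \<in> {1..Suc k}"
    show "(\<forall>m. (ws(Suc k := w)) i m \<in> V) \<and> (qs(Suc k := q)) i \<in> sos_values \<and>
      (\<Sum>m\<in>monomials n 2. ((ws(Suc k := w)) i m)\<^sup>2) +
      (\<Sum>m\<in>monomials n 2. X m * (ws(Suc k := w)) (i - 1) m) + (qs(Suc k := q)) i = 0"
    proof (cases "i = Suc k")
      case True
      then show ?thesis using w ws(2) by (simp del: One_nat_def)
    next
      case False
      then have "i \<in> {1..k}" "i - 1 \<noteq> Suc k" using i by auto
      then show ?thesis using ws(3) False by (simp del: One_nat_def)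
    qed
  qed
  then show ?case using ws(1)
    by (intro exI[of _ "ws(Suc k := w)"] exI[of _ "qs(Suc k := q)"]) auto
qed

end

section \<open>Certificates as matrices\<close>

lemma symmetric_mats_iff:
  "B \<in> symmetric_mats k \<longleftrightarrow> B \<in> carrier_mat k k \<and> symm_on k (\<lambda>i j. B $$ (i, j))"
proof (cases "B \<in> carrier_mat k k")
  case True
  then have "B\<^sup>T = B \<longleftrightarrow> (\<forall>i<k. \<forall>j<k. B $$ (i, j) = B $$ (j, i))"
    by (auto simp: mat_eq_iff)
  then show ?thesis using True by (simp add: symmetric_mats_def symm_on_def)
qed (simp add: symmetric_mats_def)

lemma quadratic_form_eq_bform:
  fixes B :: "real mat"
  assumes "B \<in> carrier_mat k k" "v \<in> carrier_vec k"
  shows "v \<bullet> (B *\<^sub>v v) = bform k (\<lambda>i j. B $$ (i, j)) (\<lambda>i. v $ i) (\<lambda>i. v $ i)"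
  using assms by (simp add: scalar_prod_def bform_def atLeast0LessThan sum_distrib_left ac_simps)

lemma psd_mats_iff:
  "B \<in> psd_mats k \<longleftrightarrow> B \<in> carrier_mat k k \<and> psd_on k (\<lambda>i j. B $$ (i, j))"
proof -
  have "(\<forall>v\<in>carrier_vec k. 0 \<le> v \<bullet> (B *\<^sub>v v)) \<longleftrightarrow> (\<forall>v. 0 \<le> bform k (\<lambda>i j. B $$ (i, j)) v v)"
    if B: "B \<in> carrier_mat k k"
  proof (intro iffI allI ballI)
    fix v assume "\<forall>v\<in>carrier_vec k. 0 \<le> v \<bullet> (B *\<^sub>v v)"
    then have "0 \<le> vec k v \<bullet> (B *\<^sub>v vec k v)" by simp
    also have "\<dots> = bform k (\<lambda>i j. B $$ (i, j)) v v"
      using B by (subst quadratic_form_eq_bform) (auto simp: bform_def)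
    finally show "0 \<le> bform k (\<lambda>i j. B $$ (i, j)) v v" .
  next
    fix v :: "real vec" assume "\<forall>v. 0 \<le> bform k (\<lambda>i j. B $$ (i, j)) v v" "v \<in> carrier_vec k"
    then show "0 \<le> v \<bullet> (B *\<^sub>v v)" using B by (simp add: quadratic_form_eq_bform)
  qed
  then show ?thesis by (auto simp: psd_mats_def symmetric_mats_iff psd_on_def)
qed

lemma mat_trace_mult:
  assumes "A \<in> carrier_mat a a" "B \<in> carrier_mat a a"
  shows "mat_trace (A * B) = (\<Sum>i<a. \<Sum>j<a. A $$ (i, j) * B $$ (j, i))"
  using assms by (auto simp: mat_trace_def scalar_prod_def atLeast0LessThan)

lemma mat_trace_gram:
  assumes "A \<in> carrier_mat a a" "P \<in> carrier_mat t a"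
  shows "mat_trace (A * (P\<^sup>T * P)) = (\<Sum>k<t. bform a (\<lambda>i j. A $$ (i, j)) (\<lambda>i. P $$ (k, i)) (\<lambda>i. P $$ (k, i)))"
proof -
  have "mat_trace (A * (P\<^sup>T * P)) = (\<Sum>i<a. \<Sum>j<a. \<Sum>k<t. A $$ (i, j) * P $$ (k, i) * P $$ (k, j))"
    using assms
    by (subst mat_trace_mult) (auto simp: scalar_prod_def atLeast0LessThan sum_distrib_left ac_simps intro!: sum.cong)
  also have "\<dots> = (\<Sum>i<a. \<Sum>k<t. \<Sum>j<a. A $$ (i, j) * P $$ (k, i) * P $$ (k, j))"
    by (intro sum.cong refl sum.swap)
  also have "\<dots> = (\<Sum>k<t. bform a (\<lambda>i j. A $$ (i, j)) (\<lambda>i. P $$ (k, i)) (\<lambda>i. P $$ (k, i)))"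
    unfolding bform_def by (rule sum.swap)
  finally show ?thesis .
qed

lemma bform_gram:
  assumes "W \<in> carrier_mat r s"
  shows "bform s (\<lambda>i j. (W\<^sup>T * W) $$ (i, j)) u v = (\<Sum>k<r. (\<Sum>i<s. W $$ (k, i) * u i) * (\<Sum>j<s. W $$ (k, j) * v j))"
proof -
  have "bform s (\<lambda>i j. (W\<^sup>T * W) $$ (i, j)) u v
      = (\<Sum>i<s. \<Sum>j<s. \<Sum>k<r. W $$ (k, i) * u i * (W $$ (k, j) * v j))"
    using assms unfolding bform_def
    by (intro sum.cong refl) (simp add: scalar_prod_def atLeast0LessThan sum_distrib_right sum_distrib_left ac_simps)
  also have "\<dots> = (\<Sum>i<s. \<Sum>k<r. \<Sum>j<s. W $$ (k, i) * u i * (W $$ (k, j) * v j))"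
    by (intro sum.cong refl sum.swap)
  also have "\<dots> = (\<Sum>k<r. \<Sum>i<s. \<Sum>j<s. W $$ (k, i) * u i * (W $$ (k, j) * v j))"
    by (rule sum.swap)
  finally show ?thesis by (simp add: sum_product)
qed

lemma eval_monomial_form:
  assumes "W \<in> carrier_mat (num_monomials n d) (num_monomials n e)"
  shows "eval_rpoly x (monomial_form n d W e) = (\<Sum>i<num_monomials n d. eval_monomial x (monomial_list n d ! i) *
      (\<Sum>j<num_monomials n e. W $$ (i, j) * eval_monomial x (monomial_list n e ! j)))"
  unfolding monomial_form_eq[OF assms]
  by (simp add: eval_rpoly_sum eval_rpoly_mult eval_rpoly_single)

section \<open>Coefficient matrices of families of linear polynomials\<close>

definition coefficient_mat :: "nat \<Rightarrow> (monomial \<Rightarrow> rpoly) \<Rightarrow> real mat"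
  where "coefficient_mat n w = mat (num_monomials n 2) (num_monomials n 1)
    (\<lambda>(i, j). Poly_Mapping.lookup (w (monomial_list n 2 ! i)) (monomial_list n 1 ! j))"

lemma coefficient_mat_carrier: "coefficient_mat n w \<in> carrier_mat (num_monomials n 2) (num_monomials n 1)"
  by (simp add: coefficient_mat_def)

lemma coefficient_mat_row:
  assumes "\<And>m. w m \<in> rpolys_upto n 1" "i < num_monomials n 2"
  shows "(\<Sum>j<num_monomials n 1. Const (coefficient_mat n w $$ (i, j)) * X (monomial_list n 1 ! j))
    = w (monomial_list n 2 ! i)"
proof -
  let ?p = "w (monomial_list n 2 ! i)"
  have "(\<Sum>j<num_monomials n 1. Const (coefficient_mat n w $$ (i, j)) * X (monomial_list n 1 ! j))
      = (\<Sum>j<num_monomials n 1. Const (Poly_Mapping.lookup ?p (monomial_list n 1 ! j)) * X (monomial_list n 1 ! j))"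
    using assms(2) by (simp add: coefficient_mat_def)
  also have "\<dots> = (\<Sum>m\<in>monomials n 1. Const (Poly_Mapping.lookup ?p m) * X m)"
    by (rule sum_num_monomials)
  also have "\<dots> = ?p"
    using assms(1) by (intro rpoly_expand[symmetric] finite_monomials) (simp flip: rpolys_upto_iff del: One_nat_def)
  finally show ?thesis .
qed

lemma monomial_form_coefficient_mat:
  assumes "\<And>m. w m \<in> rpolys_upto n 1"
  shows "monomial_form n 2 (coefficient_mat n w) 1 = (\<Sum>m\<in>monomials n 2. X m * w m)"
proof -
  have "monomial_form n 2 (coefficient_mat n w) 1
      = (\<Sum>i<num_monomials n 2. X (monomial_list n 2 ! i) * w (monomial_list n 2 ! i))"
    unfolding monomial_form_eq[OF coefficient_mat_carrier]
    by (intro sum.cong refl) (simp only: coefficient_mat_row[of w, OF assms] lessThan_iff)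
  also have "\<dots> = (\<Sum>m\<in>monomials n 2. X m * w m)"
    by (rule sum_num_monomials)
  finally show ?thesis .
qed

text \<open>The vector W m_1 has the entries \<open>w m\<close>, and the form is its squared length.
  Lifting \<open>W\<close> to constant polynomials makes \<open>bform_gram\<close> applicable over
  the polynomial ring.\<close>

lemma monomial_form_gram:
  assumes "\<And>m. w m \<in> rpolys_upto n 1"
  shows "monomial_form n 1 ((coefficient_mat n w)\<^sup>T * coefficient_mat n w) 1 = (\<Sum>m\<in>monomials n 2. (w m)\<^sup>2)"
proof -
  let ?W = "coefficient_mat n w" and ?s = "num_monomials n 1" and ?l = "monomial_list n 1"
  let ?C = "map_mat Const ?W"
  have W: "?W \<in> carrier_mat (num_monomials n 2) ?s" by (rule coefficient_mat_carrier)
  then have C: "?C \<in> carrier_mat (num_monomials n 2) ?s" by simp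
  have entry: "Const ((?W\<^sup>T * ?W) $$ (i, j)) = (?C\<^sup>T * ?C) $$ (i, j)" if "i < ?s" "j < ?s" for i j
    using that W by (simp add: scalar_prod_def Const_sum Const_mult)
  have "monomial_form n 1 (?W\<^sup>T * ?W) 1 = (\<Sum>i<?s. X (?l ! i) * (\<Sum>j<?s. Const ((?W\<^sup>T * ?W) $$ (i, j)) * X (?l ! j)))"
    using W by (intro monomial_form_eq) simp
  also have "\<dots> = bform ?s (\<lambda>i j. (?C\<^sup>T * ?C) $$ (i, j)) (\<lambda>i. X (?l ! i)) (\<lambda>i. X (?l ! i))"
    unfolding bform_def sum_distrib_left
    by (intro sum.cong refl) (simp only: entry lessThan_iff ac_simps)
  also have "\<dots> = (\<Sum>k<num_monomials n 2. (\<Sum>i<?s. ?C $$ (k, i) * X (?l ! i)) * (\<Sum>j<?s. ?C $$ (k, j) * X (?l ! j)))"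
    by (rule bform_gram[OF C])
  also have "\<dots> = (\<Sum>k<num_monomials n 2. (w (monomial_list n 2 ! k))\<^sup>2)"
  proof (intro sum.cong refl)
    fix k assume k: "k \<in> {..<num_monomials n 2}"
    have "(\<Sum>i<?s. ?C $$ (k, i) * X (?l ! i)) = (\<Sum>i<?s. Const (?W $$ (k, i)) * X (?l ! i))"
      using k W by (intro sum.cong refl) simp
    also have "\<dots> = w (monomial_list n 2 ! k)"
      using k by (intro coefficient_mat_row assms) simp
    finally show "(\<Sum>i<?s. ?C $$ (k, i) * X (?l ! i)) * (\<Sum>j<?s. ?C $$ (k, j) * X (?l ! j)) = (w (monomial_list n 2 ! k))\<^sup>2"
      by (simp only: power2_eq_square)
  qed
  also have "\<dots> = (\<Sum>m\<in>monomials n 2. (w m)\<^sup>2)"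
    by (rule sum_num_monomials)
  finally show ?thesis .
qed

section \<open>Pencils, sums of squares and spectrahedra in matrix form\<close>

lemma elements_mat_subset_iff:
  "elements_mat B \<subseteq> T \<longleftrightarrow> (\<forall>i<dim_row B. \<forall>j<dim_col B. B $$ (i, j) \<in> T)"
  by (auto simp: elements_mat_def image_subset_iff UN_subset_iff)

lemma linear_pencil_imp_pencil:
  assumes "linear_pencil n a A"
  shows "A \<in> carrier_mat a a" "pencil n a (\<lambda>i j. A $$ (i, j))"
proof -
  show A: "A \<in> carrier_mat a a"
    using assms by (auto simp: linear_pencil_def symmetric_mats_def)
  show "pencil n a (\<lambda>i j. A $$ (i, j))"
  proof
    show "symm_on a (\<lambda>i j. A $$ (i, j))"
      using assms by (auto simp: linear_pencil_def symmetric_mats_iff)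
    show "A $$ (i, j) \<in> rpolys_upto n 1" if "i < a" "j < a" for i j
      using assms that A unfolding linear_pencil_def elements_mat_subset_iff by blast
  qed
qed

text \<open>The vectors of the list become the rows of \<open>P\<close>; their entries have degree
  at most 1, so P^T P is quadratic.\<close>

lemma sos_values_imp_quadratic_sos_matrix:
  assumes A: "linear_pencil n a A" and q: "q \<in> pencil.sos_values n a (\<lambda>i j. A $$ (i, j))"
  shows "\<exists>Q. quadratic_sos_matrix n a Q \<and> mat_trace (A * Q) = q"
proof -
  interpret pencil n a "\<lambda>i j. A $$ (i, j)" using linear_pencil_imp_pencil(2)[OF A] .
  note A = linear_pencil_imp_pencil(1)[OF A]
  obtain ws where q: "q = sum_list (map (\<lambda>w. bform a (\<lambda>i j. A $$ (i, j)) w w) ws)" and ws: "\<forall>w\<in>set ws. \<forall>i. w i \<in> V"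
    using q by (auto simp: sos_values_def)
  define P where "P = mat (length ws) a (\<lambda>(k, i). (ws ! k) i)"
  have P: "P \<in> carrier_mat (length ws) a" by (simp add: P_def)
  have PV: "P $$ (k, i) \<in> V" if "k < length ws" "i < a" for k i
    using that ws by (simp add: P_def del: One_nat_def)
  have "elements_mat P \<subseteq> rpolys n"
    using P PV by (auto simp: elements_mat_subset_iff rpolys_upto_def)
  moreover have "elements_mat (P\<^sup>T * P) \<subseteq> rpolys_upto n 2"
  proof -
    have "(P\<^sup>T * P) $$ (i, j) \<in> rpolys_upto n 2" if "i < a" "j < a" for i j
    proof -
      have "(P\<^sup>T * P) $$ (i, j) = (\<Sum>k<length ws. P $$ (k, i) * P $$ (k, j))"
        using that P by (simp add: scalar_prod_def atLeast0LessThan)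
      also have "\<dots> \<in> rpolys_upto n (1 + 1)"
        using that by (intro rpolys_upto_sum rpolys_upto_mult PV) auto
      finally show ?thesis by (simp add: numeral_2_eq_2)
    qed
    then show ?thesis using P by (simp add: elements_mat_subset_iff)
  qed
  ultimately have "quadratic_sos_matrix n a (P\<^sup>T * P)"
    unfolding quadratic_sos_matrix_def sos_matrix_def using P by blast
  moreover have "mat_trace (A * (P\<^sup>T * P)) = q"
  proof -
    have "mat_trace (A * (P\<^sup>T * P)) = (\<Sum>k<length ws. bform a (\<lambda>i j. A $$ (i, j)) (ws ! k) (ws ! k))"
      unfolding mat_trace_gram[OF A P] by (intro sum.cong refl) (simp add: P_def bform_def)
    also have "\<dots> = q" unfolding q by (simp add: sum_list_sum_nth atLeast0LessThan)
    finally show ?thesis .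
  qed
  ultimately show ?thesis by blast
qed

lemma psd_ge_refl: "psd_ge k (W\<^sup>T * W) (W\<^sup>T * W)" if "W \<in> carrier_mat r k" for W :: "real mat"
proof -
  have "W\<^sup>T * W \<in> symmetric_mats k"
    using that by (auto simp: symmetric_mats_iff symm_on_def scalar_prod_def ac_simps)
  moreover have "W\<^sup>T * W - W\<^sup>T * W \<in> psd_mats k"
    using that by (auto simp: psd_mats_iff psd_on_def symm_on_def bform_def)
  ultimately show ?thesis by (simp add: psd_ge_def)
qed

text \<open>At \<open>x\<close> the trace is the sum of the values of the semidefinite form A(x) at
  the rows of P(x).\<close>

lemma eval_trace_sos_nonneg:
  assumes A: "A \<in> carrier_mat a a" and x: "psd_on a (\<lambda>i j. eval_rpoly x (A $$ (i, j)))" and Q: "sos_matrix n a Q"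
  shows "0 \<le> eval_rpoly x (mat_trace (A * Q))"
proof -
  obtain t P where P: "P \<in> carrier_mat t a" "Q = P\<^sup>T * P" using Q by (auto simp: sos_matrix_def)
  have "eval_rpoly x (mat_trace (A * Q)) = (\<Sum>k<t. bform a (\<lambda>i j. eval_rpoly x (A $$ (i, j)))
      (\<lambda>i. eval_rpoly x (P $$ (k, i))) (\<lambda>i. eval_rpoly x (P $$ (k, i))))"
    unfolding P(2) mat_trace_gram[OF A P(1)] by (simp add: bform_def eval_rpoly_sum eval_rpoly_mult)
  then show ?thesis using x by (simp add: psd_on_def sum_nonneg)
qed

lemma mat_trace_Const:
  assumes "A \<in> carrier_mat a a" "B \<in> symmetric_mats a"
  shows "mat_trace (A * map_mat Const B) = (\<Sum>i<a. \<Sum>j<a. A $$ (i, j) * Const (B $$ (i, j)))"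
proof -
  have B: "B \<in> carrier_mat a a" "\<And>i j. i < a \<Longrightarrow> j < a \<Longrightarrow> B $$ (j, i) = B $$ (i, j)"
    using assms(2) by (auto simp: symmetric_mats_iff symm_on_def)
  then show ?thesis using assms(1) by (subst mat_trace_mult) auto
qed

text \<open>At \<open>x\<close> the trace is the sum of the values of A(x) at the Gram vectors of
  \<open>S\<close>.\<close>

lemma eval_trace_psd_nonneg:
  assumes A: "A \<in> carrier_mat a a" and x: "psd_on a (\<lambda>i j. eval_rpoly x (A $$ (i, j)))" and S: "S \<in> psd_mats a"
  shows "0 \<le> eval_rpoly x (mat_trace (A * map_mat Const S))"
proof -
  have "S \<in> symmetric_mats a" using S by (simp add: psd_mats_def)
  note tr = mat_trace_Const[OF A this]
  obtain u where u: "\<And>i j. i < a \<Longrightarrow> j < a \<Longrightarrow> S $$ (i, j) = (\<Sum>k<a. u k i * u k j)"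
    using S psd_on_gram[of a "\<lambda>i j. S $$ (i, j)"] unfolding psd_mats_iff by metis
  have "eval_rpoly x (mat_trace (A * map_mat Const S))
      = (\<Sum>i<a. \<Sum>j<a. \<Sum>k<a. eval_rpoly x (A $$ (i, j)) * u k i * u k j)"
    unfolding tr by (simp add: eval_rpoly_sum eval_rpoly_mult u sum_distrib_left mult.assoc)
  also have "\<dots> = (\<Sum>i<a. \<Sum>k<a. \<Sum>j<a. eval_rpoly x (A $$ (i, j)) * u k i * u k j)"
    by (intro sum.cong refl sum.swap)
  also have "\<dots> = (\<Sum>k<a. bform a (\<lambda>i j. eval_rpoly x (A $$ (i, j))) (u k) (u k))"
    unfolding bform_def by (rule sum.swap)
  finally show ?thesis using x by (simp add: psd_on_def sum_nonneg)
qed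

lemma spectrahedron_iff:
  assumes "linear_pencil n a A"
  shows "x \<in> spectrahedron n A \<longleftrightarrow> x \<in> carrier_vec n \<and> psd_on a (\<lambda>i j. eval_rpoly x (A $$ (i, j)))"
proof -
  have A: "A \<in> carrier_mat a a" using linear_pencil_imp_pencil(1)[OF assms] .
  have "bform a (\<lambda>i j. map_mat (eval_rpoly x) A $$ (i, j)) v v = bform a (\<lambda>i j. eval_rpoly x (A $$ (i, j))) v v" for v
    using A by (simp add: bform_def)
  then have "psd_on a (\<lambda>i j. map_mat (eval_rpoly x) A $$ (i, j)) \<longleftrightarrow> psd_on a (\<lambda>i j. eval_rpoly x (A $$ (i, j)))"
    using A by (simp add: psd_on_def symm_on_def)
  then show ?thesis using A by (simp add: spectrahedron_def psd_mats_iff)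
qed

section \<open>Soundness of certificates, and the equivalence\<close>

lemma certificate_sound:
  fixes U W :: "nat \<Rightarrow> real mat"
  assumes A: "linear_pencil n a A" and x: "x \<in> spectrahedron n A"
    and Q: "\<forall>i\<in>{1..n}. quadratic_sos_matrix n a (Q i)"
    and W: "\<forall>i\<in>{1..n}. W i \<in> carrier_mat (num_monomials n 2) (num_monomials n 1)"
    and W0: "W 0 = 0\<^sub>m (num_monomials n 2) (num_monomials n 1)"
    and S: "S \<in> psd_mats a" and c: "0 \<le> c"
    and step: "\<forall>i\<in>{1..n}. monomial_form n 1 (U i) 1 + monomial_form n 2 (W (i - 1)) 1 + mat_trace (A * Q i) = 0"
    and U: "\<forall>i\<in>{1..n}. psd_ge (num_monomials n 1) (U i) ((W i)\<^sup>T * W i)"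
    and f: "f - Const c + monomial_form n 2 (W n) 1 - mat_trace (A * map_mat Const S) = 0"
  shows "0 \<le> eval_rpoly x f"
proof -
  have Ac: "A \<in> carrier_mat a a" using linear_pencil_imp_pencil(1)[OF A] .
  have psd: "psd_on a (\<lambda>i j. eval_rpoly x (A $$ (i, j)))" using x spectrahedron_iff[OF A] by blast
  let ?s1 = "num_monomials n 1" and ?s2 = "num_monomials n 2"
  \<comment> \<open>The vector m_1(x). The induction below shows that every matrix
    \<open>W i\<close> annihilates it.\<close>
  define \<nu> where "\<nu> j = eval_monomial x (monomial_list n 1 ! j)" for j
  have Wc: "W i \<in> carrier_mat ?s2 ?s1" if "i \<le> n" for i
    using that W W0 by (cases "i = 0") auto
  have form: "eval_rpoly x (monomial_form n 2 (W i) 1) = 0"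
    if "i \<le> n" "\<forall>r<?s2. (\<Sum>j<?s1. W i $$ (r, j) * \<nu> j) = 0" for i
    unfolding eval_monomial_form[OF Wc[OF that(1)]] \<nu>_def[symmetric] using that(2) by simp
  have zero: "\<forall>r<?s2. (\<Sum>j<?s1. W i $$ (r, j) * \<nu> j) = 0" if "i \<le> n" for i
    using that
  proof (induction i)
    case 0
    then show ?case using W0 by simp
  next
    case (Suc i)
    then have i: "Suc i \<in> {1..n}" "i \<le> n" by auto
    let ?G = "(W (Suc i))\<^sup>T * W (Suc i)"
    have Uc: "U (Suc i) \<in> carrier_mat ?s1 ?s1" and G: "?G \<in> carrier_mat ?s1 ?s1"
      and diff: "psd_on ?s1 (\<lambda>i' j. (U (Suc i) - ?G) $$ (i', j))"
      using U i(1) by (auto simp: psd_ge_def symmetric_mats_iff psd_mats_iff simp del: One_nat_def)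
    have "eval_rpoly x (monomial_form n 1 (U (Suc i)) 1) + eval_rpoly x (mat_trace (A * Q (Suc i))) = 0"
      using arg_cong[OF step[rule_format, OF i(1)], of "eval_rpoly x"] form[OF i(2) Suc.IH[OF i(2)]]
      by (simp add: eval_rpoly_add)
    moreover have "0 \<le> eval_rpoly x (mat_trace (A * Q (Suc i)))"
      using Q i(1) by (intro eval_trace_sos_nonneg[OF Ac psd]) (auto simp: quadratic_sos_matrix_def)
    moreover have "eval_rpoly x (monomial_form n 1 (U (Suc i)) 1) = bform ?s1 (\<lambda>i' j. U (Suc i) $$ (i', j)) \<nu> \<nu>"
      unfolding eval_monomial_form[OF Uc] bform_def \<nu>_def[symmetric] by (simp add: sum_distrib_left ac_simps)
    moreover have "0 \<le> bform ?s1 (\<lambda>i' j. (U (Suc i) - ?G) $$ (i', j)) \<nu> \<nu>"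
      using diff by (simp add: psd_on_def)
    then have "bform ?s1 (\<lambda>i' j. ?G $$ (i', j)) \<nu> \<nu> \<le> bform ?s1 (\<lambda>i' j. U (Suc i) $$ (i', j)) \<nu> \<nu>"
    proof -
      have "bform ?s1 (\<lambda>i' j. (U (Suc i) - ?G) $$ (i', j)) \<nu> \<nu>
          = bform ?s1 (\<lambda>i' j. U (Suc i) $$ (i', j)) \<nu> \<nu> - bform ?s1 (\<lambda>i' j. ?G $$ (i', j)) \<nu> \<nu>"
        unfolding bform_def sum_subtractf[symmetric] using Uc G
        by (intro sum.cong refl) (simp add: left_diff_distrib del: index_mult_mat)
      then show ?thesis using \<open>0 \<le> bform ?s1 (\<lambda>i' j. (U (Suc i) - ?G) $$ (i', j)) \<nu> \<nu>\<close> by simp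
    qed
    \<comment> \<open>The squared length of \<open>W (Suc i)\<close> applied to m_1(x) is at most
      the form of \<open>U (Suc i)\<close> there, which is minus a nonnegative trace.\<close>
    ultimately have "(\<Sum>r<?s2. (\<Sum>j<?s1. W (Suc i) $$ (r, j) * \<nu> j)\<^sup>2) \<le> 0"
      unfolding bform_gram[OF Wc[OF Suc.prems]] power2_eq_square by linarith
    then have "(\<Sum>r<?s2. (\<Sum>j<?s1. W (Suc i) $$ (r, j) * \<nu> j)\<^sup>2) = 0"
      by (intro antisym sum_nonneg) auto
    then show ?case by (simp add: sum_nonneg_eq_0_iff)
  qed
  have "eval_rpoly x f - c - eval_rpoly x (mat_trace (A * map_mat Const S)) = 0"
    using arg_cong[OF f, of "eval_rpoly x"] form[OF order_refl zero[OF order_refl]]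
    by (simp add: eval_rpoly_add eval_rpoly_diff)
  then show ?thesis using c eval_trace_psd_nonneg[OF Ac psd S] by linarith
qed

theorem theorem3p7p3:
  fixes n \<alpha> :: nat and A :: "rpoly mat" and f :: rpoly
  assumes "linear_pencil n \<alpha> A"
    and "f \<in> rpolys_upto n 1"
  shows "(\<forall>x\<in>spectrahedron n A. 0 \<le> eval_rpoly x f) \<longleftrightarrow>
    (\<exists>(Q :: nat \<Rightarrow> rpoly mat) (U :: nat \<Rightarrow> real mat) (W :: nat \<Rightarrow> real mat) (S :: real mat) (c :: real).
      (\<forall>i\<in>{1..n}. quadratic_sos_matrix n \<alpha> (Q i)) \<and>
      (\<forall>i\<in>{1..n}. U i \<in> symmetric_mats (num_monomials n 1)) \<and>
      (\<forall>i\<in>{1..n}. W i \<in> carrier_mat (num_monomials n 2) (num_monomials n 1)) \<and>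
      W 0 = 0\<^sub>m (num_monomials n 2) (num_monomials n 1) \<and>
      S \<in> psd_mats \<alpha> \<and> 0 \<le> c \<and>
      (\<forall>i\<in>{1..n}. monomial_form n 1 (U i) 1 + monomial_form n 2 (W (i - 1)) 1
        + mat_trace (A * Q i) = 0) \<and>
      (\<forall>i\<in>{1..n}. psd_ge (num_monomials n 1) (U i) ((W i)\<^sup>T * W i)) \<and>
      f - Const c + monomial_form n 2 (W n) 1 - mat_trace (A * map_mat Const S) = 0)"
  (is "?lhs \<longleftrightarrow> ?rhs")
proof
  assume ?rhs
  then show ?lhs using certificate_sound[OF assms(1)] by blast
next
  assume nonneg: ?lhs
  interpret pencil n \<alpha> "\<lambda>i j. A $$ (i, j)" using linear_pencil_imp_pencil(2)[OF assms(1)] .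
  have A: "A \<in> carrier_mat \<alpha> \<alpha>" using linear_pencil_imp_pencil(1)[OF assms(1)] .
  have "nonneg_on_pencil f"
    using nonneg spectrahedron_iff[OF assms(1)] by (simp add: nonneg_on_pencil_def)
  from certificate_exists[OF assms(2) this] obtain c S' w where c: "0 \<le> c" and S': "psd_on \<alpha> S'" and w: "chain n w"
    and f: "f - Const c + (\<Sum>m\<in>monomials n 2. X m * w m) - trp S' = 0" by blast
  from chain_sequence[OF w] obtain ws qs where ws0: "\<forall>m. ws 0 m = 0" and wsn: "ws n = w"
    and ws: "\<forall>i\<in>{1..n}. (\<forall>m. ws i m \<in> V) \<and> qs i \<in> sos_values \<and>
      (\<Sum>m\<in>monomials n 2. (ws i m)\<^sup>2) + (\<Sum>m\<in>monomials n 2. X m * ws (i - 1) m) + qs i = 0" by blast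
  have "\<forall>i\<in>{1..n}. \<exists>Q. quadratic_sos_matrix n \<alpha> Q \<and> mat_trace (A * Q) = qs i"
    using ws sos_values_imp_quadratic_sos_matrix[OF assms(1)] by blast
  then obtain Q where Q: "\<forall>i\<in>{1..n}. quadratic_sos_matrix n \<alpha> (Q i) \<and> mat_trace (A * Q i) = qs i" by metis
  define W where "W i = coefficient_mat n (ws i)" for i
  define U where "U i = (W i)\<^sup>T * W i" for i
  define S where "S = mat \<alpha> \<alpha> (\<lambda>(i, j). S' i j)"
  have W: "W i \<in> carrier_mat (num_monomials n 2) (num_monomials n 1)" for i
    unfolding W_def by (rule coefficient_mat_carrier)
  \<comment> \<open>The index 0 is included, since the first identity refers to
    \<open>W 0\<close>.\<close>
  have V: "ws i m \<in> V" if "i \<le> n" for i m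
    using that ws ws0 by (cases "i = 0") (auto simp del: One_nat_def)
  have U: "psd_ge (num_monomials n 1) (U i) ((W i)\<^sup>T * W i)" for i
    unfolding U_def by (rule psd_ge_refl[OF W])
  have W0: "W 0 = 0\<^sub>m (num_monomials n 2) (num_monomials n 1)"
    using ws0 by (auto simp: W_def coefficient_mat_def)
  have step: "monomial_form n 1 (U i) 1 + monomial_form n 2 (W (i - 1)) 1 + mat_trace (A * Q i) = 0"
    if i: "i \<in> {1..n}" for i
  proof -
    have le: "i \<le> n" "i - 1 \<le> n" using i by auto
    have "monomial_form n 1 (U i) 1 = (\<Sum>m\<in>monomials n 2. (ws i m)\<^sup>2)"
      unfolding U_def W_def by (rule monomial_form_gram[OF V[OF le(1)]])
    moreover have "monomial_form n 2 (W (i - 1)) 1 = (\<Sum>m\<in>monomials n 2. X m * ws (i - 1) m)"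
      unfolding W_def by (rule monomial_form_coefficient_mat[OF V[OF le(2)]])
    moreover have "mat_trace (A * Q i) = qs i" using Q i by blast
    moreover have "(\<Sum>m\<in>monomials n 2. (ws i m)\<^sup>2) + (\<Sum>m\<in>monomials n 2. X m * ws (i - 1) m) + qs i = 0"
      using ws i by blast
    ultimately show ?thesis by (simp only:)
  qed
  have "bform \<alpha> (\<lambda>i j. S $$ (i, j)) v v = bform \<alpha> S' v v" for v
    by (simp add: bform_def S_def)
  then have S: "S \<in> psd_mats \<alpha>"
    using S' by (simp add: psd_mats_iff psd_on_def symm_on_def) (simp add: S_def)
  then have "mat_trace (A * map_mat Const S) = trp S'"
    by (subst mat_trace_Const[OF A]) (auto simp: psd_mats_def trp_def S_def)
  moreover have "monomial_form n 2 (W n) 1 = (\<Sum>m\<in>monomials n 2. X m * w m)"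
    unfolding W_def wsn[symmetric] by (intro monomial_form_coefficient_mat V order_refl)
  ultimately have "f - Const c + monomial_form n 2 (W n) 1 - mat_trace (A * map_mat Const S) = 0"
    using f by simp
  moreover have "U i \<in> symmetric_mats (num_monomials n 1)" for i using U by (simp add: psd_ge_def)
  ultimately show ?rhs using Q W W0 S c step U by blast
qed

end
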